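(* Let $n$ and $d$ be integers with $2\le d\le n-2$. If $G$ is a unicyclic graph on $n$ vertices with diameter $d$ which has maximum $SLEE$ among all unicyclic graphs on $n$ vertices with diameter $d$, then $G\cong G^{d}$.
   Context: All graphs are simple, finite and undirected. For a graph $G$ on $n$ vertices, the signless Laplacian matrix is $Q=D+A$, where $A$ is the adjacency matrix and $D$ is the diagonal matrix of vertex degrees. If $q_1,\dots,q_n$ are the eigenvalues of $Q$ (with multiplicity), the signless Laplacian Estrada index is $SLEE(G)=\sum_{i=1}^n e^{q_i}$. A unicyclic graph is a connected graph with the same number of vertices and edges (equivalently, a connected graph with a unique cycle). The graph $G^{d}$ (on $n$ vertices) is obtained from a path $v_0v_1\cdots v_d$ on $d+1$ vertices by attaching $n-d-2$ pendent vertices to $v_a$, where $a=\lfloor d/2\rfloor$, and adding one further new vertex $u$ adjacent to exactly $v_a$ and $v_{a+1}$. *)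

theory Defs
  imports
    "Graph_Theory.Graph_Theory"
    "Jordan_Normal_Form.Char_Poly"
    "HOL-Library.Countable_Set"
begin

text \<open>
  A simple finite undirected graph is a \<open>pair_graph\<close>: a finite loop-free digraph without
  parallel arcs whose arc set is symmetric, so that every undirected edge is represented by
  two opposite arcs.
\<close>

definition edges :: "'a pair_pre_digraph \<Rightarrow> 'a set set" where
  "edges G = (\<lambda>(u, v). {u, v}) ` parcs G"

text \<open>The qualified name separates graph connectedness from the topological notion.\<close>

definition unicyclic :: "'a pair_pre_digraph \<Rightarrow> bool" where
  "unicyclic G \<longleftrightarrow>
     pair_graph G \<and> Digraph_Component.connected (with_proj G) \<and>
     card (edges G) = card (pverts G)"

text \<open>\<open>wf_digraph.\<mu>\<close> is the shortest-path distance; unit weights count the edges of a walk.\<close>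

definition graph_diameter :: "'a pair_pre_digraph \<Rightarrow> ereal" where
  "graph_diameter G =
     (SUP u \<in> pverts G. SUP v \<in> pverts G. wf_digraph.\<mu> (with_proj G) (\<lambda>_. 1) u v)"

text \<open>
  Rows and columns are indexed by \<open>0, ..., card (pverts G) - 1\<close> through the enumeration
  \<open>from_nat_into (pverts G)\<close>, which is a bijection onto \<open>pverts G\<close> for finite graphs. Another
  enumeration would give a permutation-similar matrix, hence the same characteristic polynomial.
\<close>

definition adjacency_mat :: "'a pair_pre_digraph \<Rightarrow> real mat" where
  "adjacency_mat G = mat (card (pverts G)) (card (pverts G))
     (\<lambda>(i, j). if (from_nat_into (pverts G) i, from_nat_into (pverts G) j) \<in> parcs G
               then 1 else 0)"

definition degree_mat :: "'a pair_pre_digraph \<Rightarrow> real mat" where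
  "degree_mat G = mat (card (pverts G)) (card (pverts G))
     (\<lambda>(i, j). if i = j then real (out_degree (with_proj G) (from_nat_into (pverts G) i))
               else 0)"

definition signless_laplacian :: "'a pair_pre_digraph \<Rightarrow> real mat" where
  "signless_laplacian G = degree_mat G + adjacency_mat G"

text \<open>
  The eigenvalues with multiplicity are the multiset of roots of the characteristic polynomial;
  the matrix being real symmetric, all its eigenvalues are real.
\<close>

definition SLEE :: "'a pair_pre_digraph \<Rightarrow> real" where
  "SLEE G = (\<Sum>q \<in># proots (char_poly (signless_laplacian G)). exp q)"

text \<open>
  The graph \<open>G\<^sup>d\<close> on \<open>n\<close> vertices, for \<open>d + 2 \<le> n\<close>: vertices \<open>0, ..., d\<close> form the path
  \<open>v\<^sub>0 ... v\<^sub>d\<close>, the vertex \<open>d + 1\<close> is \<open>u\<close>, and \<open>d + 2, ..., n - 1\<close> are the \<open>n - d - 2\<close> pendent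
  vertices attached to \<open>v\<^sub>a\<close>.
\<close>

definition extremal_graph :: "nat \<Rightarrow> nat \<Rightarrow> nat pair_pre_digraph" where
  "extremal_graph n d =
     (let a = d div 2;
          E = {(i, i + 1) | i. i < d} \<union> {(a, w) | w. d + 2 \<le> w \<and> w < n} \<union>
              {(d + 1, a), (d + 1, a + 1)}
      in \<lparr> pverts = {0..<n}, parcs = E \<union> E\<inverse> \<rparr>)"

end

theory Submission
  imports Defs "Jordan_Normal_Form.Schur_Decomposition" "HOL-Combinatorics.Transposition"
begin

text \<open>
Let \<open>Q\<close> be the signless Laplacian of a graph. The exponential series gives
\<open>SLEE = \<Sum>k. tr (Q ^ k) / k!\<close>, so a change of the graph that decreases none of these traces and
increases one of them increases \<open>SLEE\<close>. All comparisons below are of this kind, and all of them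
are instances of one operation.

\<^bold>\<open>Compression.\<close> Let the involution \<open>\<sigma>\<close> exchange a vertex set \<open>R\<close> with a disjoint set \<open>\<sigma> R\<close> and fix
every other vertex, and suppose that an edge that meets both sets is mapped to itself. Replace every
edge that meets \<open>R\<close> but not \<open>\<sigma> R\<close> by its mirror image, unless the mirror image is present already.
The matrix \<open>Q\<close> is the sum over the edges of the squares of their incidence vectors. In the
orthonormal basis of the vectors \<open>(\<sigma> r + r) / \<surd>2\<close> and \<open>(\<sigma> r - r) / \<surd>2\<close> an incidence vector has a
negative coordinate only through its antisymmetric part, mirror images differ by the sign of that
part, and a pair of mirror edges contributes nothing to the entries that mix the two parts.
Compression therefore leaves the unmixed entries, which are nonnegative, unchanged and turns every
mixed entry \<open>\<alpha> - \<beta>\<close> with \<open>\<alpha>, \<beta> \<ge> 0\<close> into \<open>\<alpha> + \<beta>\<close>. The new matrix dominates the absolute value of the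
old one, and no trace decreases. Some trace increases as soon as an edge at \<open>R\<close> moves, an edge at
\<open>\<sigma> R\<close> lacks a mirror image, and the two places are joined inside \<open>R\<close>: the matrix then has a closed
walk that uses exactly one \<open>\<beta>\<close> (\<open>estrada_compress\<close>, based on \<open>mtrace_mpow_strict\<close>).

\<^bold>\<open>The extremal argument.\<close> A compression may lower the diameter. The condition ``diameter \<open>d\<close>'' is
therefore relaxed to ``diameter at least \<open>d\<close>'', which has a certificate that is easy to follow: a
path \<open>v 0, \<dots>, v d\<close> and a level function \<open>f\<close> that changes by at most one along every edge and has
\<open>f (v k) = k\<close> (\<open>geodesic\<close>). A graph that maximises \<open>SLEE\<close> in this larger class admits no compression
that stays in the class and increases \<open>SLEE\<close>. This has two consequences. Two vertices of equal level at distance at most two have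
nested neighbourhoods, up to the two vertices themselves, unless both lie on the path
(\<open>nested_neighbourhoods\<close>). And if the path is folded along \<open>k \<mapsto> s - k\<close> at an axis right of its centre,
then a vertex off the path that is attached right of the axis is attached to the mirror image as well
(\<open>attached_beyond_axis\<close>); here the part of the path that sticks out on the left supplies the edge
without a mirror image. Two triangles cannot share an edge in a connected graph with one cycle, so
folding confines all attachments to the middle of the path. A last fold, at the centre, and a
reversal of the path if necessary ensure that every vertex off the path that is attached to the path is adjacent to \<open>v a\<close>, \<open>a = d div 2\<close>
(\<open>all_attached_at_centre\<close>). Comparing neighbourhoods shows that every vertex off the path is attached
(\<open>off_path_adjacent_to_centre\<close>). With the path these edges number \<open>n - 1\<close>, and for a suitable
choice of the path the last edge completes a triangle on \<open>v a\<close> and \<open>v (a + 1)\<close>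
(\<open>extremal_shape_if_star\<close>).

\<^bold>\<open>Conclusion.\<close> A maximiser of the larger class is thus \<open>G\<^sup>d\<close>, whose diameter is exactly \<open>d\<close>. It competes
with the given graph \<open>G\<close>, so \<open>G\<close> is a maximiser of the larger class too and is isomorphic to \<open>G\<^sup>d\<close>.
\<close>

section \<open>Matrices as functions on a finite set\<close>

definition mmul :: "'a set \<Rightarrow> ('a \<Rightarrow> 'a \<Rightarrow> real) \<Rightarrow> ('a \<Rightarrow> 'a \<Rightarrow> real) \<Rightarrow> 'a \<Rightarrow> 'a \<Rightarrow> real" where
  "mmul V A B = (\<lambda>a b. \<Sum>c\<in>V. A a c * B c b)"

primrec mpow :: "'a set \<Rightarrow> ('a \<Rightarrow> 'a \<Rightarrow> real) \<Rightarrow> nat \<Rightarrow> 'a \<Rightarrow> 'a \<Rightarrow> real" where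
  "mpow V A 0 = (\<lambda>a b. of_bool (a = b))"
| "mpow V A (Suc k) = mmul V A (mpow V A k)"

definition mtrace :: "'a set \<Rightarrow> ('a \<Rightarrow> 'a \<Rightarrow> real) \<Rightarrow> real" where
  "mtrace V A = (\<Sum>a\<in>V. A a a)"

lemma mmul_assoc: "mmul V (mmul V A B) C = mmul V A (mmul V B C)"
proof (intro ext)
  fix a b
  have "mmul V (mmul V A B) C a b = (\<Sum>c\<in>V. \<Sum>d\<in>V. A a d * B d c * C c b)"
    by (simp add: mmul_def sum_distrib_right)
  also have "\<dots> = (\<Sum>d\<in>V. \<Sum>c\<in>V. A a d * B d c * C c b)" by (rule sum.swap)
  also have "\<dots> = mmul V A (mmul V B C) a b"
    by (simp add: mmul_def sum_distrib_left mult.assoc)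
  finally show "mmul V (mmul V A B) C a b = mmul V A (mmul V B C) a b" .
qed

lemma mtrace_mmul_commute: "mtrace V (mmul V A B) = mtrace V (mmul V B A)"
  unfolding mtrace_def mmul_def by (subst sum.swap) (simp add: mult.commute)

lemma mmul_cong:
  assumes "\<And>c. c \<in> V \<Longrightarrow> A a c = A' a c" "\<And>c. c \<in> V \<Longrightarrow> B c b = B' c b"
  shows "mmul V A B a b = mmul V A' B' a b"
  using assms by (simp add: mmul_def)

lemma mmul_one_left:
  assumes "finite V" "a \<in> V" "\<And>c. c \<in> V \<Longrightarrow> I a c = of_bool (a = c)"
  shows "mmul V I B a b = B a b"
proof -
  have "mmul V I B a b = (\<Sum>c\<in>V. if c = a then B a b else 0)"
    unfolding mmul_def by (rule sum.cong) (use assms in auto)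
  then show ?thesis using assms by (simp add: sum.delta)
qed

lemma mpow_cong: 
  assumes "\<And>a b. a \<in> V \<Longrightarrow> b \<in> V \<Longrightarrow> A a b = B a b" "a \<in> V" "b \<in> V"
  shows "mpow V A k a b = mpow V B k a b"
  using assms(2,3)
proof (induction k arbitrary: a b)
  case (Suc k)
  then show ?case unfolding mpow.simps by (intro mmul_cong assms(1)) auto
qed simp

lemma mpow_Suc_right:
  assumes fin: "finite V" and "a \<in> V" "b \<in> V"
  shows "mpow V A (Suc k) a b = mmul V (mpow V A k) A a b"
  using assms(2)
proof (induction k arbitrary: a)
  case 0
  have "mmul V A (mpow V A 0) a b = A a b"
  proof -
    have "mmul V A (mpow V A 0) a b = (\<Sum>c\<in>V. if c = b then A a b else 0)"
      unfolding mmul_def by (rule sum.cong) auto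
    then show ?thesis using assms by (simp add: sum.delta)
  qed
  then show ?case using mmul_one_left[OF fin 0] by simp
next
  case (Suc k)
  have "mpow V A (Suc (Suc k)) a b = mmul V A (mpow V A (Suc k)) a b" by simp
  also have "\<dots> = mmul V A (mmul V (mpow V A k) A) a b"
    by (rule mmul_cong) (use Suc.IH in auto)
  finally show ?case by (simp add: mmul_assoc)
qed

lemma mpow_conjugate:
  assumes fin: "finite V"
    and inv: "\<And>a b. a \<in> V \<Longrightarrow> b \<in> V \<Longrightarrow> mmul V S S a b = of_bool (a = b)"
    and "a \<in> V" "b \<in> V"
  shows "mpow V (mmul V S (mmul V A S)) k a b = mmul V S (mmul V (mpow V A k) S) a b"
  using assms(3,4)
proof (induction k arbitrary: a b)
  case 0
  have "mmul V S (mmul V (mpow V A 0) S) a b = mmul V S S a b"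
    by (rule mmul_cong) (simp_all add: mmul_one_left[OF fin])
  then show ?case using inv 0 by simp
next
  case (Suc k)
  let ?M = "mmul V S (mmul V A S)"
  have "mpow V ?M (Suc k) a b = mmul V ?M (mpow V ?M k) a b" by simp
  also have "\<dots> = mmul V ?M (mmul V S (mmul V (mpow V A k) S)) a b"
    by (rule mmul_cong) (use Suc in auto)
  also have "\<dots> = mmul V S (mmul V A (mmul V (mmul V S S) (mmul V (mpow V A k) S))) a b"
    by (simp add: mmul_assoc)
  also have "\<dots> = mmul V S (mmul V A (mmul V (mpow V A k) S)) a b"
    by (intro mmul_cong refl mmul_one_left[OF fin] inv)
  also have "\<dots> = mmul V S (mmul V (mpow V A (Suc k)) S) a b" by (simp add: mmul_assoc)
  finally show ?case .
qed

lemma mtrace_mpow_conjugate: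
  assumes fin: "finite V"
    and inv: "\<And>a b. a \<in> V \<Longrightarrow> b \<in> V \<Longrightarrow> mmul V S S a b = of_bool (a = b)"
  shows "mtrace V (mpow V (mmul V S (mmul V A S)) k) = mtrace V (mpow V A k)"
proof -
  have "mtrace V (mpow V (mmul V S (mmul V A S)) k) = mtrace V (mmul V S (mmul V (mpow V A k) S))"
    unfolding mtrace_def by (rule sum.cong) (use mpow_conjugate[OF fin inv] in auto)
  also have "\<dots> = mtrace V (mmul V (mmul V (mpow V A k) S) S)" by (rule mtrace_mmul_commute)
  also have "\<dots> = mtrace V (mmul V (mmul V S S) (mpow V A k))"
    by (simp add: mmul_assoc mtrace_mmul_commute[of V "mpow V A k"])
  also have "\<dots> = mtrace V (mpow V A k)"
    unfolding mtrace_def by (intro sum.cong refl mmul_one_left[OF fin] inv)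
  finally show ?thesis .
qed

lemma mpow_abs_le:
  assumes dom: "\<forall>a\<in>V. \<forall>b\<in>V. \<bar>M a b\<bar> \<le> N a b" and "a \<in> V" "b \<in> V"
  shows "\<bar>mpow V M k a b\<bar> \<le> mpow V N k a b"
  using assms(2,3)
proof (induction k arbitrary: a b)
  case (Suc k)
  have "\<bar>mpow V M (Suc k) a b\<bar> \<le> (\<Sum>c\<in>V. \<bar>M a c\<bar> * \<bar>mpow V M k c b\<bar>)"
    by (simp add: mmul_def abs_mult[symmetric])
  also have "\<dots> \<le> (\<Sum>c\<in>V. N a c * mpow V N k c b)"
  proof (intro sum_mono mult_mono)
    fix c assume "c \<in> V"
    then show "\<bar>M a c\<bar> \<le> N a c" "0 \<le> N a c" using dom Suc.prems abs_ge_zero order_trans by blast+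
  qed (use Suc in auto)
  finally show ?case by (simp add: mmul_def)
qed simp

text \<open>
Write \<open>N = M\<^sup>+ + M\<^sup>-\<close> and \<open>M = M\<^sup>+ - M\<^sup>-\<close>, where \<open>M\<^sup>+\<close> and \<open>M\<^sup>-\<close> are nonnegative if \<open>N\<close> dominates \<open>\<bar>M\<bar>\<close>. Then
\<open>(N ^ k + M ^ k) / 2\<close> counts the walks with an even number of \<open>M\<^sup>-\<close>-steps and \<open>(N ^ k - M ^ k) / 2\<close>
those with an odd number. This identity and the next one are the recursions that split off the first
step of a walk.
\<close>

lemma mpow_Suc_diff:
  "2 * (mpow V N (Suc k) a b - mpow V M (Suc k) a b) =
     (\<Sum>c\<in>V. (N a c + M a c) * (mpow V N k c b - mpow V M k c b)
           + (N a c - M a c) * (mpow V N k c b + mpow V M k c b))"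
  unfolding mpow.simps mmul_def sum_distrib_left sum_subtractf[symmetric]
  by (intro sum.cong refl) (simp add: algebra_simps)

lemma mpow_Suc_sum:
  "2 * (mpow V N (Suc k) a b + mpow V M (Suc k) a b) =
     (\<Sum>c\<in>V. (N a c + M a c) * (mpow V N k c b + mpow V M k c b)
           + (N a c - M a c) * (mpow V N k c b - mpow V M k c b))"
  unfolding mpow.simps mmul_def sum_distrib_left sum.distrib[symmetric]
  by (intro sum.cong refl) (simp add: algebra_simps)

text \<open>
A walk along entries with \<open>M\<^sup>+ > 0\<close> has no \<open>M\<^sup>-\<close>-step and hence contributes to the even part.
\<close>

lemma even_walk_pos:
  assumes fin: "finite V"
    and dom: "\<forall>a\<in>V. \<forall>b\<in>V. \<bar>M a b\<bar> \<le> N a b"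
    and walk: "(a, b) \<in> {(a, b). a \<in> V \<and> b \<in> V \<and> N a b + M a b > 0}\<^sup>*" and "b \<in> V"
  shows "a \<in> V \<and> (\<exists>k. mpow V N k a b + mpow V M k a b > 0)"
  using walk
proof (induction rule: converse_rtrancl_induct)
  case base
  show ?case using \<open>b \<in> V\<close> by (auto intro!: exI[of _ 0])
next
  case (step a c)
  then obtain k where k: "mpow V N k c b + mpow V M k c b > 0" by auto
  have ac: "a \<in> V" "c \<in> V" "N a c + M a c > 0" using step.hyps by auto
  have pos: "0 \<le> N a d + M a d \<and> 0 \<le> N a d - M a d \<and> 0 \<le> mpow V N k d b + mpow V M k d b
      \<and> 0 \<le> mpow V N k d b - mpow V M k d b" if "d \<in> V" for d
    using bspec[OF bspec[OF dom ac(1)] that] mpow_abs_le[OF dom that \<open>b \<in> V\<close>, where k = k] by auto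
  have "0 < (\<Sum>c\<in>V. (N a c + M a c) * (mpow V N k c b + mpow V M k c b)
           + (N a c - M a c) * (mpow V N k c b - mpow V M k c b))"
    by (rule sum_pos2[OF fin ac(2)])
       (use pos ac k in \<open>auto intro!: add_pos_nonneg add_nonneg_nonneg mult_nonneg_nonneg\<close>)
  then have "0 < mpow V N (Suc k) a b + mpow V M (Suc k) a b"
    unfolding mpow_Suc_sum[symmetric] by simp
  then show ?case using ac by blast
qed

lemma mtrace_mpow_mono:
  assumes dom: "\<forall>a\<in>V. \<forall>b\<in>V. \<bar>M a b\<bar> \<le> N a b"
  shows "mtrace V (mpow V M k) \<le> mtrace V (mpow V N k)"
  unfolding mtrace_def
proof (rule sum_mono)
  fix a assume "a \<in> V"
  then show "mpow V M k a a \<le> mpow V N k a a" using mpow_abs_le[OF dom, where a = a and b = a and k = k] by linarith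
qed

text \<open>
The excess \<open>tr (N ^ k) - tr (M ^ k)\<close> is twice the weight of the closed walks with an odd number of
\<open>M\<^sup>-\<close>-steps. One \<open>M\<^sup>-\<close>-step from \<open>a\<close> to \<open>b\<close> that can be closed by \<open>M\<^sup>+\<close>-steps makes it positive for
some \<open>k\<close>. No length is prescribed, since the closing walk may be long.
\<close>

lemma mtrace_mpow_strict:
  assumes fin: "finite V"
    and dom: "\<forall>a\<in>V. \<forall>b\<in>V. \<bar>M a b\<bar> \<le> N a b"
    and ab: "a \<in> V" "b \<in> V" "M a b < N a b"
    and walk: "(b, a) \<in> {(a, b). a \<in> V \<and> b \<in> V \<and> N a b + M a b > 0}\<^sup>*"
  shows "\<exists>k. mtrace V (mpow V M k) < mtrace V (mpow V N k)"
proof -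
  from even_walk_pos[OF fin dom walk ab(1)] obtain k
    where k: "mpow V N k b a + mpow V M k b a > 0" by blast
  have pos: "0 \<le> N a d + M a d \<and> 0 \<le> N a d - M a d \<and> 0 \<le> mpow V N k d a + mpow V M k d a
      \<and> 0 \<le> mpow V N k d a - mpow V M k d a" if "d \<in> V" for d
    using bspec[OF bspec[OF dom ab(1)] that] mpow_abs_le[OF dom that ab(1), where k = k] by auto
  have "0 < (\<Sum>c\<in>V. (N a c + M a c) * (mpow V N k c a - mpow V M k c a)
           + (N a c - M a c) * (mpow V N k c a + mpow V M k c a))"
  proof (rule sum_pos2[OF fin ab(2)])
    show "0 < (N a b + M a b) * (mpow V N k b a - mpow V M k b a)
           + (N a b - M a b) * (mpow V N k b a + mpow V M k b a)"
      using pos[OF ab(2)] ab k by (intro add_nonneg_pos[OF mult_nonneg_nonneg mult_pos_pos]) auto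
  qed (use pos in \<open>auto intro!: add_nonneg_nonneg mult_nonneg_nonneg\<close>)
  then have less: "mpow V M (Suc k) a a < mpow V N (Suc k) a a"
    unfolding mpow_Suc_diff[symmetric] by simp
  have "mtrace V (mpow V M (Suc k)) < mtrace V (mpow V N (Suc k))"
    unfolding mtrace_def
  proof (rule sum_strict_mono_ex1[OF fin])
    show "\<forall>x\<in>V. mpow V M (Suc k) x x \<le> mpow V N (Suc k) x x"
    proof
      fix x assume "x \<in> V"
      then show "mpow V M (Suc k) x x \<le> mpow V N (Suc k) x x"
        using mpow_abs_le[OF dom, where a = x and b = x and k = "Suc k"] by linarith
    qed
  qed (use less ab in blast)
  then show ?thesis by blast
qed

section \<open>Exponential sums over eigenvalues as series of traces\<close>

text \<open>
Over the complex numbers the characteristic polynomial splits. A root \<open>a\<close> with eigenvector \<open>x\<close>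
satisfies \<open>x\<^sup>* A x = a |x|\<^sup>2\<close>, where the left side is real by symmetry, so all roots are real.
\<close>

lemma symmetric_real_mat_char_poly_splits:
  fixes A :: "real mat"
  assumes A: "A \<in> carrier_mat n n" and sym: "\<And>i j. i < n \<Longrightarrow> j < n \<Longrightarrow> A $$ (i, j) = A $$ (j, i)"
  shows "\<exists>es. char_poly A = (\<Prod>e\<leftarrow>es. [:- e, 1:])"
proof -
  interpret cp: map_poly_inj_comm_ring_hom complex_of_real ..
  let ?C = "map_mat complex_of_real A"
  have C: "?C \<in> carrier_mat n n" using A by simp
  obtain as where as: "char_poly ?C = (\<Prod>a\<leftarrow>as. [:- a, 1:])"
    using char_poly_factorized[OF C] by blast
  have real: "a \<in> range complex_of_real" if "a \<in> set as" for a
  proof -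
    have "poly (char_poly ?C) a = 0"
      using that unfolding as by (auto simp: poly_prod_list prod_list_zero_iff)
    then obtain x where x: "eigenvector ?C x a"
      using eigenvalue_root_char_poly[OF C] unfolding eigenvalue_def by blast
    then have xn: "dim_vec x = n" and x0: "x \<noteq> 0\<^sub>v n" and eig: "?C *\<^sub>v x = a \<cdot>\<^sub>v x"
      using A by (auto simp: eigenvector_def)
    define h where "h = (\<Sum>i<n. \<Sum>j<n. cnj (x $ i) * complex_of_real (A $$ (i, j)) * x $ j)"
    define s where "s = (\<Sum>i<n. cmod (x $ i) ^ 2)"
    have row: "(\<Sum>j<n. complex_of_real (A $$ (i, j)) * x $ j) = a * x $ i" if "i < n" for i
    proof -
      have "(?C *\<^sub>v x) $ i = (\<Sum>j<n. complex_of_real (A $$ (i, j)) * x $ j)"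
        using that A xn by (simp add: scalar_prod_def lessThan_atLeast0)
      then show ?thesis using eig that xn by simp
    qed
    have "h = (\<Sum>i<n. cnj (x $ i) * (\<Sum>j<n. complex_of_real (A $$ (i, j)) * x $ j))"
      by (simp add: h_def sum_distrib_left mult.assoc)
    also have "\<dots> = (\<Sum>i<n. cnj (x $ i) * (a * x $ i))" by (simp add: row)
    also have "\<dots> = a * of_real s"
      unfolding s_def of_real_sum sum_distrib_left
      by (intro sum.cong refl) (simp only: complex_norm_square mult_ac)
    finally have h: "h = a * of_real s" .
    have "cnj h = (\<Sum>i<n. \<Sum>j<n. x $ i * complex_of_real (A $$ (i, j)) * cnj (x $ j))"
      by (simp add: h_def)
    also have "\<dots> = (\<Sum>j<n. \<Sum>i<n. x $ i * complex_of_real (A $$ (i, j)) * cnj (x $ j))"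
      by (rule sum.swap)
    also have "\<dots> = h" unfolding h_def
      by (intro sum.cong refl) (simp add: sym mult_ac)
    finally have "cnj h = h" .
    have "s \<noteq> 0"
    proof
      assume "s = 0"
      then have "\<forall>i<n. x $ i = 0" unfolding s_def by (subst (asm) sum_nonneg_eq_0_iff) auto
      then have "x = 0\<^sub>v n" using xn by (intro eq_vecI) auto
      then show False using x0 by simp
    qed
    then have "cnj a = a" using \<open>cnj h = h\<close> unfolding h by simp
    then show ?thesis by (metis Reals_cnj_iff Reals_def)
  qed
  then obtain es where es: "as = map complex_of_real es"
    by (metis ex_map_conv rangeE)
  have "map_poly complex_of_real (char_poly A) = map_poly complex_of_real (\<Prod>e\<leftarrow>es. [:- e, 1:])"
    unfolding of_real_hom.char_poly_hom[OF A, symmetric] as es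
    by (simp add: cp.hom_prod_list o_def)
  then have "char_poly A = (\<Prod>e\<leftarrow>es. [:- e, 1:])" by (rule cp.injectivity)
  then show ?thesis by blast
qed

definition jtrace :: "real mat \<Rightarrow> real" where
  "jtrace A = (\<Sum>i<dim_row A. A $$ (i, i))"

lemma jtrace_commute:
  assumes "A \<in> carrier_mat n n" "B \<in> carrier_mat n n"
  shows "jtrace (A * B) = jtrace (B * A)"
proof -
  have "jtrace (A * B) = (\<Sum>i<n. \<Sum>j<n. A $$ (i, j) * B $$ (j, i))"
    using assms by (simp add: jtrace_def scalar_prod_def lessThan_atLeast0)
  also have "\<dots> = (\<Sum>j<n. \<Sum>i<n. A $$ (i, j) * B $$ (j, i))" by (rule sum.swap)
  also have "\<dots> = jtrace (B * A)"
    using assms by (simp add: jtrace_def scalar_prod_def lessThan_atLeast0 mult.commute)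
  finally show ?thesis .
qed

lemma upper_triangular_pow:
  fixes B :: "real mat"
  assumes B: "B \<in> carrier_mat n n" and ut: "upper_triangular B"
  shows "upper_triangular (B ^\<^sub>m k) \<and> (\<forall>i<n. (B ^\<^sub>m k) $$ (i, i) = (B $$ (i, i)) ^ k)"
proof (induction k)
  case 0
  then show ?case using B by simp
next
  case (Suc k)
  have C: "B ^\<^sub>m k \<in> carrier_mat n n" using B by simp
  have z1: "B $$ (i, j) = 0" if "j < i" "i < n" for i j using ut that B by auto
  have z2: "(B ^\<^sub>m k) $$ (i, j) = 0" if "j < i" "i < n" for i j using Suc that C by auto
  have ent: "(B ^\<^sub>m Suc k) $$ (i, j) = (\<Sum>l<n. (B ^\<^sub>m k) $$ (i, l) * B $$ (l, j))"
    if "i < n" "j < n" for i j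
    using that B C by (simp add: scalar_prod_def lessThan_atLeast0)
  have "(B ^\<^sub>m Suc k) $$ (i, j) = 0" if "j < i" "i < n" for i j
  proof -
    have "(B ^\<^sub>m k) $$ (i, l) * B $$ (l, j) = 0" if "l < n" for l
      using z1[of j l] z2[of l i] \<open>j < i\<close> \<open>i < n\<close> that by (cases "l < i") auto
    then have "(\<Sum>l<n. (B ^\<^sub>m k) $$ (i, l) * B $$ (l, j)) = 0" by (intro sum.neutral) auto
    then show ?thesis using ent[of i j] that by simp
  qed
  moreover have "(B ^\<^sub>m Suc k) $$ (i, i) = (B $$ (i, i)) ^ Suc k" if "i < n" for i
  proof -
    have "(B ^\<^sub>m k) $$ (i, l) * B $$ (l, i) = (if l = i then (B ^\<^sub>m k) $$ (i, i) * B $$ (i, i) else 0)"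
      if "l < n" for l
      using z1[of i l] z2[of l i] \<open>i < n\<close> that by (cases "l < i") auto
    then have "(\<Sum>l<n. (B ^\<^sub>m k) $$ (i, l) * B $$ (l, i)) =
        (\<Sum>l<n. if l = i then (B ^\<^sub>m k) $$ (i, i) * B $$ (i, i) else 0)"
      by (intro sum.cong) auto
    also have "\<dots> = (B $$ (i, i)) ^ k * B $$ (i, i)" using that Suc by (simp add: sum.delta)
    finally show ?thesis unfolding ent[OF that that] by (simp add: mult.commute)
  qed
  moreover have "dim_row (B ^\<^sub>m Suc k) = n" using B C by simp
  ultimately show ?case by (auto simp del: pow_mat.simps(2))
qed

text \<open>
Schur triangularisation replaces \<open>A\<close> by a similar triangular matrix whose diagonal lists the
eigenvalues; powers of it have the powers of the eigenvalues on the diagonal.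
\<close>

lemma jtrace_pow_eigenvalues:
  fixes A :: "real mat"
  assumes A: "A \<in> carrier_mat n n" and es: "char_poly A = (\<Prod>e\<leftarrow>es. [:- e, 1:])"
  shows "jtrace (A ^\<^sub>m k) = (\<Sum>e\<leftarrow>es. e ^ k)"
proof -
  obtain B P Q where sd: "schur_decomposition A es = (B, P, Q)" by (metis prod_cases3)
  from schur_decomposition[OF A es sd] have wit: "similar_mat_wit A B P Q"
    and ut: "upper_triangular B" and diag: "diag_mat B = es" by auto
  from similar_mat_witD2[OF A wit] have B: "B \<in> carrier_mat n n" and P: "P \<in> carrier_mat n n"
    and Q: "Q \<in> carrier_mat n n" and QP: "Q * P = 1\<^sub>m n" by auto
  have Bk: "B ^\<^sub>m k \<in> carrier_mat n n" using B by simp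
  have "jtrace (A ^\<^sub>m k) = jtrace (P * (B ^\<^sub>m k * Q))"
    using similar_mat_wit_pow_id[OF wit] assoc_mult_mat[OF P Bk Q] by metis
  also have "\<dots> = jtrace (B ^\<^sub>m k * Q * P)" using P Bk Q by (intro jtrace_commute[of _ n]) auto
  also have "\<dots> = jtrace (B ^\<^sub>m k)" using assoc_mult_mat[OF Bk Q P] QP right_mult_one_mat[OF Bk] by simp
  also have "\<dots> = (\<Sum>i<n. (B $$ (i, i)) ^ k)"
    using upper_triangular_pow[OF B ut] Bk by (auto simp: jtrace_def intro!: sum.cong)
  also have "\<dots> = (\<Sum>e\<leftarrow>es. e ^ k)"
    unfolding diag[symmetric] diag_mat_def using B
    by (simp add: sum_list_distinct_conv_sum_set o_def lessThan_atLeast0 flip: interv_sum_list_conv_sum_set_nat)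
  finally show ?thesis .
qed

lemma jtrace_pow_enumerated:
  assumes bij: "bij_betw f {..<n} V" and fin: "finite V"
  shows "jtrace (mat n n (\<lambda>(i, j). F (f i) (f j)) ^\<^sub>m k) = mtrace V (mpow V F k)"
proof -
  let ?A = "mat n n (\<lambda>(i, j). F (f i) (f j))"
  have inj: "inj_on f {..<n}" using bij by (rule bij_betw_imp_inj_on)
  have ent: "(?A ^\<^sub>m k) $$ (i, j) = mpow V F k (f i) (f j)" if "i < n" "j < n" for i j
    using that
  proof (induction k arbitrary: i j)
    case 0
    then show ?case using inj by (auto dest: inj_onD)
  next
    case (Suc k)
    have C: "?A ^\<^sub>m k \<in> carrier_mat n n" by simp
    have "(?A ^\<^sub>m Suc k) $$ (i, j) = (\<Sum>l<n. (?A ^\<^sub>m k) $$ (i, l) * F (f l) (f j))"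
      using Suc.prems C by (simp add: scalar_prod_def lessThan_atLeast0)
    also have "\<dots> = (\<Sum>l<n. mpow V F k (f i) (f l) * F (f l) (f j))"
      using Suc by simp
    also have "\<dots> = mmul V (mpow V F k) F (f i) (f j)"
      unfolding mmul_def by (rule sum.reindex_bij_betw[OF bij])
    also have "\<dots> = mpow V F (Suc k) (f i) (f j)"
      using Suc.prems bij by (intro mpow_Suc_right[symmetric] fin) (auto simp: bij_betw_def)
    finally show ?case .
  qed
  have C: "?A ^\<^sub>m k \<in> carrier_mat n n" by simp
  have "jtrace (?A ^\<^sub>m k) = (\<Sum>i<n. mpow V F k (f i) (f i))"
    unfolding jtrace_def by (rule sum.cong) (use carrier_matD(1)[OF C] ent in auto)
  also have "\<dots> = mtrace V (mpow V F k)"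
    unfolding mtrace_def by (rule sum.reindex_bij_betw[OF bij])
  finally show ?thesis .
qed

lemma sum_exp_eigenvalues_sums:
  fixes F :: "'a \<Rightarrow> 'a \<Rightarrow> real"
  assumes bij: "bij_betw f {..<n} V" and fin: "finite V"
    and sym: "\<And>a b. F a b = F b a"
  shows "(\<lambda>k. mtrace V (mpow V F k) / fact k) sums
           (\<Sum>q\<in>#proots (char_poly (mat n n (\<lambda>(i, j). F (f i) (f j)))). exp q)"
proof -
  let ?A = "mat n n (\<lambda>(i, j). F (f i) (f j))"
  have A: "?A \<in> carrier_mat n n" by simp
  obtain es where es: "char_poly ?A = (\<Prod>e\<leftarrow>es. [:- e, 1:])"
    using symmetric_real_mat_char_poly_splits[OF A] sym by auto
  have roots: "proots (\<Prod>e\<leftarrow>es. [:- e, 1:]) = mset es" for es :: "real list"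
  proof (induction es)
    case (Cons e es)
    have "(\<Prod>e\<leftarrow>es. [:- e, 1:]) \<noteq> 0" by (auto simp: prod_list_zero_iff)
    then have "proots ([:- e, 1:] * (\<Prod>e\<leftarrow>es. [:- e, 1:])) = proots [:- e, 1:] + mset es"
      using Cons by (subst proots_mult) auto
    then show ?case by simp
  qed simp
  have "(\<lambda>k. (\<Sum>e\<leftarrow>es. e ^ k) / fact k) sums (\<Sum>e\<leftarrow>es. exp e)" for es :: "real list"
  proof (induction es)
    case (Cons e es)
    have "(\<lambda>k. e ^ k / fact k) sums exp e"
      using exp_converges[of e] by (simp add: divide_inverse mult.commute)
    from sums_add[OF this Cons] show ?case by (simp add: add_divide_distrib)
  qed simp
  then show ?thesis
    unfolding es roots jtrace_pow_enumerated[OF bij fin, symmetric] jtrace_pow_eigenvalues[OF A es]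
    by (metis mset_map sum_mset_sum_list)
qed

section \<open>Compression of a graph along a partial reflection\<close>

definition incidence :: "'a set \<Rightarrow> 'a \<Rightarrow> real" where
  "incidence e a = of_bool (a \<in> e)"

text \<open>
As the sum of the squares of the incidence vectors this is \<open>D + A\<close>. The form as a sum over edges is what
makes the effect of moving an edge visible.
\<close>

definition signless :: "'a set set \<Rightarrow> 'a \<Rightarrow> 'a \<Rightarrow> real" where
  "signless E a b = (\<Sum>e\<in>E. incidence e a * incidence e b)"

definition estrada :: "'a set \<Rightarrow> 'a set set \<Rightarrow> real" where
  "estrada V E = (\<Sum>k. mtrace V (mpow V (signless E) k) / fact k)"

lemma signless_commute: "signless E a b = signless E b a"
  by (simp add: signless_def mult.commute)

lemma estrada_summable:
  assumes "finite V"
  shows "summable (\<lambda>k. mtrace V (mpow V (signless E) k) / fact k)"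
proof -
  obtain f :: "nat \<Rightarrow> 'a" where "bij_betw f {..<card V} V"
    using ex_bij_betw_nat_finite[OF assms] by (auto simp: lessThan_atLeast0)
  from sum_exp_eigenvalues_sums[OF this assms signless_commute] show ?thesis
    by (rule sums_summable)
qed

lemma estrada_strict_mono:
  assumes fin: "finite V"
    and le: "\<And>k. mtrace V (mpow V (signless E) k) \<le> mtrace V (mpow V (signless E') k)"
    and less: "mtrace V (mpow V (signless E) m) < mtrace V (mpow V (signless E') m)"
  shows "estrada V E < estrada V E'"
proof -
  let ?t = "\<lambda>E k. mtrace V (mpow V (signless E) k) / fact k"
  have "0 < (\<Sum>k. ?t E' k - ?t E k)"
  proof (rule suminf_pos2)
    show "summable (\<lambda>k. ?t E' k - ?t E k)"
      by (intro summable_diff estrada_summable fin)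
    show "0 \<le> ?t E' k - ?t E k" for k using le[of k] by (simp add: divide_right_mono)
    show "0 < ?t E' m - ?t E m" using less by (simp add: divide_strict_right_mono)
  qed
  also have "\<dots> = estrada V E' - estrada V E"
    unfolding estrada_def by (intro suminf_diff[symmetric] estrada_summable fin)
  finally show ?thesis by simp
qed

locale partial_reflection =
  fixes V :: "'a set" and \<sigma> :: "'a \<Rightarrow> 'a" and R :: "'a set"
  assumes finite_V: "finite V"
    and involution: "\<sigma> (\<sigma> x) = x"
    and closed: "x \<in> V \<Longrightarrow> \<sigma> x \<in> V"
    and R_subset: "R \<subseteq> V"
    and R_disjoint: "x \<in> R \<Longrightarrow> \<sigma> x \<notin> R"
    and fixes_rest: "x \<notin> R \<Longrightarrow> \<sigma> x \<notin> R \<Longrightarrow> \<sigma> x = x"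
begin

text \<open>
The coordinates of a vector in the orthonormal basis of symmetric and antisymmetric vectors. The
symmetric coordinate of a pair is stored at the vertex in \<open>\<sigma> R\<close> and the antisymmetric one at its mirror
image in \<open>R\<close>. The base change is symmetric and its own inverse.
\<close>

definition rot :: "('a \<Rightarrow> real) \<Rightarrow> 'a \<Rightarrow> real" where
  "rot h a = (if a \<in> R then (h (\<sigma> a) - h a) / sqrt 2
              else if \<sigma> a \<in> R then (h a + h (\<sigma> a)) / sqrt 2 else h a)"

definition rot_mat :: "'a \<Rightarrow> 'a \<Rightarrow> real" where
  "rot_mat a c = rot (\<lambda>x. of_bool (x = c)) a"

lemma rot_mat_commute: "rot_mat a c = rot_mat c a"
proof (cases "c = a \<or> c = \<sigma> a")
  case True
  then show ?thesis using involution R_disjoint by (auto simp: rot_mat_def rot_def)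
next
  case False
  then show ?thesis using involution by (auto simp: rot_mat_def rot_def)
qed

lemma sum_rot_mat:
  assumes "a \<in> V"
  shows "(\<Sum>c\<in>V. rot_mat a c * h c) = rot h a"
proof -
  have d: "(\<Sum>c\<in>V. of_bool (x = c) * h c) = h x" if "x \<in> V" for x
  proof -
    have "(\<Sum>c\<in>V. of_bool (x = c) * h c) = (\<Sum>c\<in>V. if c = x then h x else 0)"
      by (intro sum.cong) auto
    then show ?thesis using that finite_V by simp
  qed
  have "(\<Sum>c\<in>V. (of_bool (\<sigma> a = c) - of_bool (a = c)) / sqrt 2 * h c) = (h (\<sigma> a) - h a) / sqrt 2"
    using assms closed
    by (simp add: left_diff_distrib diff_divide_distrib sum_subtractf d flip: sum_divide_distrib)
  moreover have "(\<Sum>c\<in>V. (of_bool (a = c) + of_bool (\<sigma> a = c)) / sqrt 2 * h c) = (h a + h (\<sigma> a)) / sqrt 2"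
    using assms closed
    by (simp add: distrib_right add_divide_distrib sum.distrib d flip: sum_divide_distrib)
  ultimately show ?thesis using assms by (simp add: rot_mat_def rot_def d)
qed

lemma rot_involution: "rot (rot h) a = h a"
  using R_disjoint involution by (auto simp: rot_def add_divide_distrib diff_divide_distrib)

lemma rot_mat_square:
  assumes "a \<in> V" "b \<in> V"
  shows "mmul V rot_mat rot_mat a b = of_bool (a = b)"
proof -
  have "mmul V rot_mat rot_mat a b = rot (\<lambda>c. rot_mat c b) a"
    unfolding mmul_def by (rule sum_rot_mat[OF assms(1)])
  also have "\<dots> = rot (rot (\<lambda>x. of_bool (x = b))) a" by (simp add: rot_mat_def[abs_def])
  finally show ?thesis by (simp add: rot_involution)
qed

lemma rot_sum: "rot (\<lambda>d. \<Sum>e\<in>E. g e * h e d) a = (\<Sum>e\<in>E. g e * rot (h e) a)"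
  by (simp add: rot_def sum_distrib_left sum_subtractf sum.distrib algebra_simps
      diff_divide_distrib add_divide_distrib sum_divide_distrib)

abbreviation rinc :: "'a set \<Rightarrow> 'a \<Rightarrow> real" where "rinc e \<equiv> rot (incidence e)"

text \<open>
The signless Laplacian in the new basis.
\<close>

definition rsignless :: "'a set set \<Rightarrow> 'a \<Rightarrow> 'a \<Rightarrow> real" where
  "rsignless E a b = (\<Sum>e\<in>E. rinc e a * rinc e b)"

lemma conjugate_signless:
  assumes "a \<in> V" "b \<in> V"
  shows "mmul V rot_mat (mmul V (signless E) rot_mat) a b = rsignless E a b"
proof -
  have "mmul V (signless E) rot_mat c b = (\<Sum>e\<in>E. rinc e b * incidence e c)" for c
  proof -
    have "mmul V (signless E) rot_mat c b = (\<Sum>d\<in>V. rot_mat b d * signless E c d)"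
      unfolding mmul_def by (intro sum.cong refl) (simp add: rot_mat_commute mult.commute)
    also have "\<dots> = (\<Sum>e\<in>E. incidence e c * rinc e b)"
      unfolding sum_rot_mat[OF assms(2)] signless_def by (rule rot_sum)
    finally show ?thesis by (simp add: mult.commute)
  qed
  then have "mmul V rot_mat (mmul V (signless E) rot_mat) a b
      = rot (\<lambda>c. \<Sum>e\<in>E. rinc e b * incidence e c) a"
    unfolding mmul_def using sum_rot_mat[OF assms(1)] by simp
  also have "\<dots> = (\<Sum>e\<in>E. rinc e b * rinc e a)" by (rule rot_sum)
  finally show ?thesis by (simp add: rsignless_def mult.commute)
qed

lemma mtrace_rsignless:
  "mtrace V (mpow V (rsignless E) k) = mtrace V (mpow V (signless E) k)"
proof -
  have "mtrace V (mpow V (rsignless E) k)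
      = mtrace V (mpow V (mmul V rot_mat (mmul V (signless E) rot_mat)) k)"
    unfolding mtrace_def by (intro sum.cong refl mpow_cong conjugate_signless[symmetric])
  also have "\<dots> = mtrace V (mpow V (signless E) k)"
    by (rule mtrace_mpow_conjugate[OF finite_V rot_mat_square])
  finally show ?thesis .
qed

definition moves :: "'a set set \<Rightarrow> 'a set \<Rightarrow> bool" where
  "moves E e \<longleftrightarrow> e \<inter> R \<noteq> {} \<and> e \<inter> \<sigma> ` R = {} \<and> \<sigma> ` e \<notin> E"

definition shift :: "'a set set \<Rightarrow> 'a set \<Rightarrow> 'a set" where
  "shift E e = (if moves E e then \<sigma> ` e else e)"

definition compress :: "'a set set \<Rightarrow> 'a set set" where
  "compress E = shift E ` E"

lemma image_image_involution [simp]: "\<sigma> ` \<sigma> ` e = e"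
  by (simp add: image_image involution)

lemma mem_image_iff: "a \<in> \<sigma> ` e \<longleftrightarrow> \<sigma> a \<in> e"
  by (metis image_iff involution)

lemma inj_on_shift: "inj_on (shift E) E"
proof (rule inj_onI)
  fix e f assume "e \<in> E" "f \<in> E" "shift E e = shift E f"
  then show "e = f"
    by (auto simp: shift_def moves_def split: if_splits) (metis image_image_involution)+
qed

lemma card_compress: "card (compress E) = card E"
  unfolding compress_def by (rule card_image[OF inj_on_shift])

text \<open>
Mirror images differ only in the sign of the antisymmetric coordinates.
\<close>

lemma rinc_image: "rinc (\<sigma> ` e) a = (if a \<in> R then - rinc e a else rinc e a)"
proof -
  consider "a \<in> R" | "a \<notin> R" "\<sigma> a \<in> R" | "\<sigma> a = a" using fixes_rest by blast
  then show ?thesis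
    using involution
    by cases (auto simp: rot_def incidence_def mem_image_iff)
qed

lemma rinc_nonneg: "a \<notin> R \<Longrightarrow> 0 \<le> rinc e a"
  by (simp add: rot_def incidence_def)

lemma rinc_nonneg_R: "a \<in> R \<Longrightarrow> e \<inter> R = {} \<Longrightarrow> 0 \<le> rinc e a"
  by (auto simp: rot_def incidence_def)

lemma rinc_nonpos_R: "a \<in> R \<Longrightarrow> e \<inter> \<sigma> ` R = {} \<Longrightarrow> rinc e a \<le> 0"
  by (auto simp: rot_def incidence_def divide_le_0_iff)

lemma rinc_zero_R: "a \<in> R \<Longrightarrow> \<sigma> ` e = e \<Longrightarrow> rinc e a = 0"
  using mem_image_iff[of a e] by (auto simp: rot_def incidence_def)

lemma rsignless_compress: "rsignless (compress E) a b = (\<Sum>e\<in>E. rinc (shift E e) a * rinc (shift E e) b)"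
  unfolding rsignless_def compress_def using sum.reindex[OF inj_on_shift] by simp

context
  fixes E :: "'a set set"
  assumes finite_E: "finite E"
    and crossing: "\<And>e. e \<in> E \<Longrightarrow> e \<inter> R \<noteq> {} \<Longrightarrow> e \<inter> \<sigma> ` R \<noteq> {} \<Longrightarrow> \<sigma> ` e = e"
begin

text \<open>
Two antisymmetric coordinates of one edge are both nonnegative if the edge avoids \<open>R\<close>, both nonpositive
if it avoids \<open>\<sigma> R\<close>, and zero if it is its own mirror image.
\<close>

lemma rinc_mult_nonneg:
  assumes "e \<in> E" "a \<in> R \<longleftrightarrow> b \<in> R"
  shows "0 \<le> rinc e a * rinc e b"
proof (cases "a \<in> R")
  case True
  with assms have "b \<in> R" by simp
  show ?thesis
  proof (cases "e \<inter> R = {} \<or> e \<inter> \<sigma> ` R = {}")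
    case True
    then show ?thesis
      using rinc_nonneg_R rinc_nonpos_R \<open>a \<in> R\<close> \<open>b \<in> R\<close>
      by (auto intro: mult_nonneg_nonneg mult_nonpos_nonpos)
  next
    case False
    then show ?thesis using crossing[OF assms(1)] rinc_zero_R[OF True] by simp
  qed
next
  case False
  then show ?thesis using assms by (simp add: rinc_nonneg)
qed

lemma rsignless_same_side:
  assumes "a \<in> R \<longleftrightarrow> b \<in> R"
  shows "rsignless (compress E) a b = rsignless E a b" "0 \<le> rsignless E a b"
proof -
  show "rsignless (compress E) a b = rsignless E a b"
    unfolding rsignless_compress unfolding rsignless_def
    by (intro sum.cong refl) (use assms in \<open>auto simp: shift_def rinc_image\<close>)
  show "0 \<le> rsignless E a b"
    unfolding rsignless_def by (intro sum_nonneg rinc_mult_nonneg assms)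
qed

text \<open>
In a mixed entry, moving an edge flips the sign of its contribution. The difference and the sum of the
mixed entries after and before compression isolate \<open>2 * \<beta>\<close>, the contribution of the moving edges,
and (in \<open>rsignless_sum\<close>) \<open>2 * \<alpha>\<close>, that of the edges outside \<open>R\<close> without a mirror image.
\<close>

lemma rsignless_diff:
  assumes "a \<notin> R" "b \<in> R"
  shows "rsignless (compress E) a b - rsignless E a b
    = (\<Sum>e\<in>E. if moves E e then 2 * rinc e a * - rinc e b else 0)"
  unfolding rsignless_compress unfolding rsignless_def sum_subtractf[symmetric]
  by (intro sum.cong refl) (use assms in \<open>auto simp: shift_def rinc_image\<close>)

lemma moves_term_nonneg:
  assumes "a \<notin> R" "b \<in> R"
  shows "0 \<le> (if moves E e then 2 * rinc e a * - rinc e b else 0)"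
proof (cases "moves E e")
  case True
  then have "rinc e b \<le> 0" using assms by (auto simp: moves_def intro: rinc_nonpos_R)
  then show ?thesis using rinc_nonneg[OF assms(1), of e] by (simp add: mult_nonneg_nonpos)
qed simp

text \<open>
An edge and its mirror image, when both are present, cancel in a mixed entry. The edges that stay and
have no mirror image avoid \<open>R\<close>: an edge that meets \<open>R\<close> and \<open>\<sigma> R\<close> is its own mirror image.
\<close>

lemma rsignless_sum:
  assumes "a \<notin> R" "b \<in> R"
  shows "rsignless (compress E) a b + rsignless E a b
    = (\<Sum>e | e \<in> E \<and> \<sigma> ` e \<notin> E \<and> e \<inter> R = {}. 2 * rinc e a * rinc e b)"
proof -
  let ?t = "\<lambda>e. 2 * rinc e a * rinc e b"
  let ?W = "{e \<in> E. \<sigma> ` e \<in> E}"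
  have "rsignless (compress E) a b + rsignless E a b = (\<Sum>e\<in>E. if moves E e then 0 else ?t e)"
    unfolding rsignless_compress unfolding rsignless_def sum.distrib[symmetric]
    by (intro sum.cong refl) (use assms in \<open>auto simp: shift_def rinc_image\<close>)
  also have "\<dots> = (\<Sum>e\<in>?W. if moves E e then 0 else ?t e) + (\<Sum>e\<in>E - ?W. if moves E e then 0 else ?t e)"
    using finite_E by (subst sum.union_disjoint[symmetric]) (auto intro!: sum.cong)
  also have "(\<Sum>e\<in>?W. if moves E e then 0 else ?t e) = 0"
  proof -
    have "sum ?t ?W = (\<Sum>e\<in>?W. ?t (\<sigma> ` e))"
      by (rule sum.reindex_bij_witness[where i = "\<lambda>e. \<sigma> ` e" and j = "\<lambda>e. \<sigma> ` e"]) auto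
    also have "\<dots> = - sum ?t ?W"
      using assms by (simp add: rinc_image sum_negf)
    finally have "sum ?t ?W = 0" by simp
    moreover have "(\<Sum>e\<in>?W. if moves E e then 0 else ?t e) = sum ?t ?W"
      by (intro sum.cong refl) (auto simp: moves_def)
    ultimately show ?thesis by simp
  qed
  also have "(\<Sum>e\<in>E - ?W. if moves E e then 0 else ?t e) =
      (\<Sum>e | e \<in> E \<and> \<sigma> ` e \<notin> E \<and> e \<inter> R = {}. ?t e)"
  proof (rule sum.mono_neutral_cong_right)
    show "\<forall>e\<in>E - ?W - {e \<in> E. \<sigma> ` e \<notin> E \<and> e \<inter> R = {}}. (if moves E e then 0 else ?t e) = 0"
    proof
      fix e assume "e \<in> E - ?W - {e \<in> E. \<sigma> ` e \<notin> E \<and> e \<inter> R = {}}"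
      then have e: "e \<in> E" "\<sigma> ` e \<notin> E" "e \<inter> R \<noteq> {}" by auto
      then have "e \<inter> \<sigma> ` R = {}" using crossing by metis
      then show "(if moves E e then 0 else ?t e) = 0" using e by (simp add: moves_def)
    qed
  qed (use finite_E in \<open>auto simp: moves_def\<close>)
  finally show ?thesis by simp
qed

lemma rsignless_commute: "rsignless F a b = rsignless F b a"
  by (simp add: rsignless_def mult.commute)

lemma rsignless_dominated: "\<bar>rsignless E a b\<bar> \<le> rsignless (compress E) a b"
proof -
  have mixed: "\<bar>rsignless E a b\<bar> \<le> rsignless (compress E) a b" if "a \<notin> R" "b \<in> R" for a b
  proof -
    have "0 \<le> rsignless (compress E) a b - rsignless E a b"
      unfolding rsignless_diff[OF that] by (intro sum_nonneg moves_term_nonneg that)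
    moreover have "0 \<le> rsignless (compress E) a b + rsignless E a b"
      unfolding rsignless_sum[OF that]
      by (intro sum_nonneg) (use that rinc_nonneg rinc_nonneg_R in simp)
    ultimately show ?thesis by linarith
  qed
  show ?thesis
  proof (cases "a \<in> R \<longleftrightarrow> b \<in> R")
    case True
    from rsignless_same_side[OF this] show ?thesis by simp
  next
    case False
    then consider "a \<notin> R" "b \<in> R" | "b \<notin> R" "a \<in> R" by blast
    then show ?thesis
      by cases (metis mixed, metis mixed rsignless_commute)
  qed
qed

lemma rsignless_edge_pos:
  assumes "r \<in> R" "r' \<in> R" "{r, r'} \<in> E"
  shows "0 < rsignless E r r'" "0 < rsignless E (\<sigma> r) (\<sigma> r')"
proof -
  have z: "rinc {r, r'} x = - 1 / sqrt 2" "rinc {r, r'} (\<sigma> x) > 0" if "x \<in> {r, r'}" for x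
    using that assms R_disjoint[of r] R_disjoint[of r'] involution
    by (auto simp: rot_def incidence_def)
  show "0 < rsignless E r r'"
    unfolding rsignless_def
    by (rule sum_pos2[OF finite_E assms(3)]) (use z rinc_mult_nonneg assms in auto)
  show "0 < rsignless E (\<sigma> r) (\<sigma> r')"
    unfolding rsignless_def
    by (rule sum_pos2[OF finite_E assms(3)])
       (use z rinc_mult_nonneg assms R_disjoint in \<open>auto intro!: mult_pos_pos\<close>)
qed

text \<open>
The closed walk that witnesses the strict increase uses the moving edge \<open>e'\<close> once, from \<open>\<sigma> r'\<close> to \<open>r'\<close>,
runs inside \<open>R\<close> from \<open>r'\<close> to \<open>r\<close>, passes to \<open>\<sigma> r\<close> through the mixed entry that \<open>e\<close> makes positive,
and returns from \<open>\<sigma> r\<close> to \<open>\<sigma> r'\<close> inside \<open>\<sigma> R\<close>. The edges inside \<open>R\<close> make the corresponding entries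
positive on both sides, because an edge of \<open>R\<close> has symmetric as well as antisymmetric coordinates.
\<close>

theorem estrada_compress:
  assumes edge_A: "e \<in> E" "e \<inter> R = {}" "\<sigma> ` e \<notin> E" "\<sigma> r \<in> e" "r \<in> R"
    and edge_B: "e' \<in> E" "e' \<inter> \<sigma> ` R = {}" "\<sigma> ` e' \<notin> E" "r' \<in> e'" "r' \<in> R"
    and conn: "(r', r) \<in> {(x, y). x \<in> R \<and> y \<in> R \<and> {x, y} \<in> E}\<^sup>*"
  shows "estrada V E < estrada V (compress E)"
proof -
  let ?M = "rsignless E" and ?N = "rsignless (compress E)"
  let ?P = "{(a, b). a \<in> V \<and> b \<in> V \<and> ?N a b + ?M a b > 0}"
  have dom: "\<forall>a\<in>V. \<forall>b\<in>V. \<bar>?M a b\<bar> \<le> ?N a b" using rsignless_dominated by blast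
  have RV: "x \<in> V" "\<sigma> x \<in> V" "\<sigma> x \<notin> R" if "x \<in> R" for x using that R_subset closed R_disjoint by auto
  have rstep: "(x, y) \<in> ?P" "(\<sigma> y, \<sigma> x) \<in> ?P" if "x \<in> R" "y \<in> R" "{x, y} \<in> E" for x y
    using rsignless_edge_pos[OF that] RV that rsignless_same_side(1)
    by (auto simp: rsignless_commute[of _ "\<sigma> y"])
  have walk: "(r', r) \<in> ?P\<^sup>* \<and> (\<sigma> r, \<sigma> r') \<in> ?P\<^sup>*"
    using conn
  proof (induction rule: rtrancl_induct)
    case (step y z)
    then have "(y, z) \<in> ?P" "(\<sigma> z, \<sigma> y) \<in> ?P" using rstep by auto
    then show ?case using step.IH by (meson converse_rtrancl_into_rtrancl rtrancl.rtrancl_into_rtrancl)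
  qed simp
  have "0 < ?N (\<sigma> r) r + ?M (\<sigma> r) r"
    unfolding rsignless_sum[OF RV(3)[OF edge_A(5)] edge_A(5)]
  proof (rule sum_pos2)
    show "e \<in> {e \<in> E. \<sigma> ` e \<notin> E \<and> e \<inter> R = {}}" using edge_A by simp
    have "r \<notin> e" using edge_A by auto
    then show "0 < 2 * rinc e (\<sigma> r) * rinc e r"
      using edge_A RV(3) involution by (simp add: rot_def incidence_def)
  qed (use finite_E edge_A RV rinc_nonneg rinc_nonneg_R in auto)
  then have "(r, \<sigma> r) \<in> ?P" using RV edge_A(5) by (simp add: rsignless_commute[of _ r])
  then have closed_walk: "(r', \<sigma> r') \<in> ?P\<^sup>*" using walk by (meson rtrancl.rtrancl_into_rtrancl rtrancl_trans)
  have "0 < ?N (\<sigma> r') r' - ?M (\<sigma> r') r'"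
    unfolding rsignless_diff[OF RV(3)[OF edge_B(5)] edge_B(5)]
  proof (rule sum_pos2[OF finite_E edge_B(1)])
    have "\<sigma> r' \<notin> e'" "moves E e'" using edge_B by (auto simp: moves_def)
    then show "0 < (if moves E e' then 2 * rinc e' (\<sigma> r') * - rinc e' r' else 0)"
      using edge_B RV(3) involution by (simp add: rot_def incidence_def)
  qed (use edge_B RV moves_term_nonneg in blast)
  then have less: "?M (\<sigma> r') r' < ?N (\<sigma> r') r'" by simp
  from mtrace_mpow_strict[OF finite_V dom RV(2)[OF edge_B(5)] RV(1)[OF edge_B(5)] less closed_walk]
  obtain m where m: "mtrace V (mpow V ?M m) < mtrace V (mpow V ?N m)" by blast
  show ?thesis
    by (rule estrada_strict_mono[OF finite_V])
       (use m mtrace_mpow_mono[OF dom] in \<open>simp_all add: mtrace_rsignless\<close>)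
qed

end

end

section \<open>Connected graphs with one cycle and a long geodesic\<close>

definition adj :: "'a set set \<Rightarrow> 'a rel" where
  "adj E = {(x, y). {x, y} \<in> E}"

definition one_cycle :: "'a set \<Rightarrow> 'a set set \<Rightarrow> bool" where
  "one_cycle V E \<longleftrightarrow> finite V \<and> (\<forall>e\<in>E. \<exists>x\<in>V. \<exists>y\<in>V. x \<noteq> y \<and> e = {x, y}) \<and>
     (\<forall>x\<in>V. \<forall>y\<in>V. (x, y) \<in> (adj E)\<^sup>*) \<and> card E = card V"

text \<open>
A certificate that the distance of \<open>v 0\<close> and \<open>v d\<close> is \<open>d\<close>, hence that the diameter is at least \<open>d\<close>: the
level \<open>f\<close> changes by at most one along an edge. Levels off the path can always be clamped to the
range \<open>1, \<dots>, d - 1\<close>. The last clause fixes this choice, so that a vertex off the path has the level of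
an inner vertex of the path.
\<close>

definition geodesic :: "'a set \<Rightarrow> 'a set set \<Rightarrow> nat \<Rightarrow> (nat \<Rightarrow> 'a) \<Rightarrow> ('a \<Rightarrow> nat) \<Rightarrow> bool" where
  "geodesic V E d v f \<longleftrightarrow>
     (\<forall>k\<le>d. v k \<in> V \<and> f (v k) = k) \<and> (\<forall>k<d. {v k, v (Suc k)} \<in> E) \<and>
     (\<forall>x y. {x, y} \<in> E \<longrightarrow> f x \<le> Suc (f y)) \<and> (\<forall>x\<in>V - v ` {..d}. 1 \<le> f x \<and> f x < d)"

lemma adj_sym: "(x, y) \<in> (adj E)\<^sup>* \<Longrightarrow> (y, x) \<in> (adj E)\<^sup>*"
  by (rule symD[OF sym_rtrancl]) (auto simp: adj_def sym_def insert_commute)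

lemma one_cycleD:
  assumes "one_cycle V E"
  shows "finite V" "finite E" "card E = card V"
    "\<And>x y. x \<in> V \<Longrightarrow> y \<in> V \<Longrightarrow> (x, y) \<in> (adj E)\<^sup>*"
    "\<And>e. e \<in> E \<Longrightarrow> \<exists>x\<in>V. \<exists>y\<in>V. x \<noteq> y \<and> e = {x, y}"
    "\<And>x y. {x, y} \<in> E \<Longrightarrow> x \<in> V \<and> y \<in> V \<and> x \<noteq> y"
proof -
  show fin: "finite V" using assms by (simp add: one_cycle_def)
  show edge: "\<And>e. e \<in> E \<Longrightarrow> \<exists>x\<in>V. \<exists>y\<in>V. x \<noteq> y \<and> e = {x, y}"
    using assms by (simp add: one_cycle_def)
  then have "E \<subseteq> Pow V" by fastforce
  then show "finite E" using fin finite_Pow_iff finite_subset by metis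
  show "x \<in> V \<and> y \<in> V \<and> x \<noteq> y" if "{x, y} \<in> E" for x y
    using edge[OF that] by (auto simp: doubleton_eq_iff)
qed (use assms in \<open>auto simp: one_cycle_def\<close>)

lemma edge_leaving:
  assumes "one_cycle V E" "S \<subseteq> V" "S \<noteq> {}" "S \<noteq> V"
  shows "\<exists>x\<in>S. \<exists>y\<in>V - S. {x, y} \<in> E"
proof -
  obtain s t where st: "s \<in> S" "t \<in> V - S" using assms by auto
  then have "(s, t) \<in> (adj E)\<^sup>*" using one_cycleD(4)[OF assms(1)] assms(2) by auto
  then have "t \<in> S \<or> (\<exists>x\<in>S. \<exists>y\<in>V - S. {x, y} \<in> E)"
  proof (induction rule: rtrancl_induct)
    case base
    show ?case using st by simp
  next
    case (step y z)
    then show ?case using one_cycleD(6)[OF assms(1)] by (auto simp: adj_def)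
  qed
  then show ?thesis using st by blast
qed

text \<open>
Starting from \<open>S\<close>, a connected graph can be exhausted by adding one vertex at a time, each with at least
one new edge. As there are as many edges as vertices in total, \<open>S\<close> cannot span more edges than vertices.
\<close>

lemma card_edges_within_le:
  assumes "one_cycle V E" "S \<subseteq> V" "S \<noteq> {}"
  shows "card {e \<in> E. e \<subseteq> S} \<le> card S"
  using assms(2,3)
proof (induction "card (V - S)" arbitrary: S)
  case 0
  then have "S = V" using one_cycleD(1)[OF assms(1)] by auto
  then show ?case using one_cycleD(2,3)[OF assms(1)] by (metis (no_types, lifting) card_mono mem_Collect_eq subsetI)
next
  case (Suc n)
  then have "S \<noteq> V" by auto
  from edge_leaving[OF assms(1) Suc.prems this] obtain x y
    where xy: "x \<in> S" "y \<in> V - S" "{x, y} \<in> E" by blast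
  have fin: "finite V" "finite E" using one_cycleD[OF assms(1)] by auto
  have "V - insert y S = (V - S) - {y}" by blast
  then have "n = card (V - insert y S)" using Suc.hyps(2) xy fin by simp
  then have "card {e \<in> E. e \<subseteq> insert y S} \<le> card (insert y S)"
    using Suc.hyps(1)[of "insert y S"] Suc.prems xy by auto
  also have "\<dots> = Suc (card S)" using xy Suc.prems fin finite_subset by fastforce
  finally have "card {e \<in> E. e \<subseteq> insert y S} \<le> Suc (card S)" .
  moreover have "card (insert {x, y} {e \<in> E. e \<subseteq> S}) \<le> card {e \<in> E. e \<subseteq> insert y S}"
    using fin xy by (intro card_mono) auto
  moreover have "card (insert {x, y} {e \<in> E. e \<subseteq> S}) = Suc (card {e \<in> E. e \<subseteq> S})"
    using fin xy by (subst card_insert_disjoint) auto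
  ultimately show ?case by simp
qed

text \<open>
Two triangles with a common edge would be five edges on four vertices.
\<close>

lemma no_two_triangles:
  assumes "one_cycle V E" and "distinct [p, q, x, y]"
    and "{p, q} \<in> E" "{p, x} \<in> E" "{q, x} \<in> E" "{p, y} \<in> E" "{q, y} \<in> E"
  shows False
proof -
  let ?S = "{p, q, x, y}" and ?F = "{{p, q}, {p, x}, {q, x}, {p, y}, {q, y}}"
  have "?S \<subseteq> V" using one_cycleD(6)[OF assms(1)] assms(3-) by blast
  then have "card {e \<in> E. e \<subseteq> ?S} \<le> 4"
    using card_edges_within_le[OF assms(1), of ?S] assms(2) by simp
  moreover have "card ?F \<le> card {e \<in> E. e \<subseteq> ?S}"
    using assms(3-) one_cycleD(2)[OF assms(1)] by (intro card_mono) auto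
  moreover have "card ?F = 5" using assms(2) by (simp add: doubleton_eq_iff)
  ultimately show False by simp
qed

section \<open>Merging neighbourhoods in a maximal graph\<close>

text \<open>
The maximum is taken over all graphs with a geodesic of length \<open>d\<close>, whatever their diameter, so that
only a geodesic has to survive a compression.
\<close>

locale maximal =
  fixes V :: "'a set" and E :: "'a set set" and d :: nat
  assumes one_cycle: "one_cycle V E" and d_ge_2: "2 \<le> d"
    and maximal: "\<And>E' v f. one_cycle V E' \<Longrightarrow> geodesic V E' d v f \<Longrightarrow> estrada V E' \<le> estrada V E"
begin

lemmas edgeD = one_cycleD(6)[OF one_cycle]

text \<open>
A compression keeps the number of edges. It keeps the graph connected if each vertex of \<open>R\<close> stays
connected to its mirror image, since then the two ends of a moved edge can still be joined through
their mirror images.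
\<close>

lemma compression_gains_nothing:
  assumes "partial_reflection V \<sigma> R"
    and crossing: "\<And>e. e \<in> E \<Longrightarrow> e \<inter> R \<noteq> {} \<Longrightarrow> e \<inter> \<sigma> ` R \<noteq> {} \<Longrightarrow> \<sigma> ` e = e"
    and linked: "\<And>r. r \<in> R \<Longrightarrow> (r, \<sigma> r) \<in> (adj (partial_reflection.compress \<sigma> R E))\<^sup>*"
    and geo: "geodesic V (partial_reflection.compress \<sigma> R E) d v f"
    and edge_A: "e \<in> E" "e \<inter> R = {}" "\<sigma> ` e \<notin> E" "\<sigma> r \<in> e" "r \<in> R"
    and edge_B: "e' \<in> E" "e' \<inter> \<sigma> ` R = {}" "\<sigma> ` e' \<notin> E" "r' \<in> e'" "r' \<in> R"
    and conn: "(r', r) \<in> {(x, y). x \<in> R \<and> y \<in> R \<and> {x, y} \<in> E}\<^sup>*"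
  shows False
proof -
  interpret partial_reflection V \<sigma> R by fact
  let ?C = "compress E"
  have shifted: "shift E e \<in> ?C" if "e \<in> E" for e using that by (simp add: compress_def)
  have simple: "\<exists>x\<in>V. \<exists>y\<in>V. x \<noteq> y \<and> e = {x, y}" if "e \<in> ?C" for e
  proof -
    obtain e0 where e0: "e0 \<in> E" "e = shift E e0" using \<open>e \<in> ?C\<close> by (auto simp: compress_def)
    then obtain x y where "x \<in> V" "y \<in> V" "x \<noteq> y" "e0 = {x, y}"
      using one_cycleD(5)[OF one_cycle] by blast
    moreover from this have "\<sigma> x \<noteq> \<sigma> y" using involution by metis
    ultimately show ?thesis using e0 closed by (auto simp: shift_def)
  qed
  have step: "(x, y) \<in> (adj ?C)\<^sup>*" if "(x, y) \<in> adj E" for x y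
  proof (cases "moves E {x, y}")
    case False
    then have "(x, y) \<in> adj ?C"
      using shifted[of "{x, y}"] that by (simp add: adj_def shift_def)
    then show ?thesis by blast
  next
    case True
    have self: "(z, \<sigma> z) \<in> (adj ?C)\<^sup>*" if "z \<in> {x, y}" for z
    proof (cases "z \<in> R")
      case False
      moreover have "\<sigma> z \<notin> R"
        using True that involution by (auto simp: moves_def image_iff)
      ultimately have "\<sigma> z = z" by (rule fixes_rest)
      then show ?thesis by simp
    qed (rule linked)
    have "(\<sigma> x, \<sigma> y) \<in> adj ?C"
      using shifted[of "{x, y}"] that True by (simp add: adj_def shift_def)
    then show ?thesis using self[of x] adj_sym[OF self[of y]] by (meson insertI1 insertI2 rtrancl.rtrancl_into_rtrancl rtrancl_trans)
  qed
  have "(adj E)\<^sup>* \<subseteq> (adj ?C)\<^sup>*"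
    by (rule rtrancl_subset_rtrancl) (use step in auto)
  then have "one_cycle V ?C"
    using one_cycleD(1,3,4)[OF one_cycle] simple card_compress unfolding one_cycle_def by auto
  from maximal[OF this geo] have "estrada V ?C \<le> estrada V E" .
  moreover have "estrada V E < estrada V ?C"
    by (rule estrada_compress[OF one_cycleD(2)[OF one_cycle] crossing edge_A edge_B conn])
  ultimately show False by simp
qed

text \<open>
Compression for the transposition of \<open>x\<close> and \<open>y\<close> with \<open>R = {y}\<close> (the Kelmans transformation) moves
the private neighbours of \<open>y\<close> to \<open>x\<close>. The level function survives because \<open>x\<close> and \<open>y\<close> have the same
level, the path because \<open>y\<close> is not on it, and connectedness because \<open>x\<close> and \<open>y\<close> stay adjacent or keep
a common neighbour.
\<close>

lemma nested_neighbourhoods: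
  assumes geo: "geodesic V E d v f"
    and xy: "x \<in> V" "y \<in> V" "x \<noteq> y" "y \<notin> v ` {..d}" "f x = f y"
    and near: "{x, y} \<in> E \<or> (\<exists>c. {x, c} \<in> E \<and> {y, c} \<in> E)"
  shows "(\<forall>w. {y, w} \<in> E \<longrightarrow> w \<noteq> x \<longrightarrow> {x, w} \<in> E) \<or> (\<forall>w. {x, w} \<in> E \<longrightarrow> w \<noteq> y \<longrightarrow> {y, w} \<in> E)"
proof (rule ccontr)
  assume "\<not> ?thesis"
  then obtain w w' where w: "{y, w} \<in> E" "w \<noteq> x" "{x, w} \<notin> E"
    and w': "{x, w'} \<in> E" "w' \<noteq> y" "{y, w'} \<notin> E" by blast
  let ?\<sigma> = "transpose x y" and ?R = "{y}"
  have pr: "partial_reflection V ?\<sigma> ?R"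
    by unfold_locales (use xy one_cycleD(1)[OF one_cycle] in \<open>auto simp: transpose_def split: if_splits\<close>)
  interpret partial_reflection V ?\<sigma> ?R by (rule pr)
  have ne: "w \<noteq> y" "w' \<noteq> x" using edgeD w(1) w'(1) by blast+
  have keep: "{p, q} \<in> compress E" if "{p, q} \<in> E" "\<not> moves E {p, q}" for p q
    using that by (force simp: compress_def shift_def)
  show False
  proof (rule compression_gains_nothing[OF pr, where e = "{x, w'}" and e' = "{y, w}" and r = y and r' = y])
    show "?\<sigma> ` e = e" if "e \<in> E" "e \<inter> ?R \<noteq> {}" "e \<inter> ?\<sigma> ` ?R \<noteq> {}" for e
    proof -
      obtain p q where "e = {p, q}" using one_cycleD(5)[OF one_cycle \<open>e \<in> E\<close>] by blast
      then have "e = {x, y}" using that xy by auto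
      then show ?thesis by auto
    qed
    show "(r, ?\<sigma> r) \<in> (adj (compress E))\<^sup>*" if "r \<in> ?R" for r
    proof -
      from near have "(x, y) \<in> (adj (compress E))\<^sup>*"
      proof
        assume "{x, y} \<in> E"
        then have "{x, y} \<in> compress E" by (intro keep) (auto simp: moves_def)
        then show ?thesis by (auto simp: adj_def)
      next
        assume "\<exists>c. {x, c} \<in> E \<and> {y, c} \<in> E"
        then obtain c where c: "{x, c} \<in> E" "{y, c} \<in> E" by blast
        then have "c \<noteq> x" "c \<noteq> y" using edgeD by blast+
        then have "?\<sigma> ` {y, c} = {x, c}" by simp
        then have "{y, c} \<in> compress E" using c by (intro keep) (auto simp: moves_def)
        moreover have "{x, c} \<in> compress E" using c by (intro keep) (auto simp: moves_def)
        ultimately have "(x, c) \<in> adj (compress E)" "(c, y) \<in> adj (compress E)"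
          by (auto simp: adj_def insert_commute)
        then show ?thesis by (meson r_into_rtrancl rtrancl_trans)
      qed
      then show ?thesis using adj_sym that by fastforce
    qed
    show "geodesic V (compress E) d v f"
      unfolding geodesic_def
    proof (intro conjI allI impI)
      fix k assume "k < d"
      then have "{v k, v (Suc k)} \<in> E" "y \<noteq> v k" "y \<noteq> v (Suc k)"
        using geo xy by (auto simp: geodesic_def)
      then show "{v k, v (Suc k)} \<in> compress E" by (intro keep) (auto simp: moves_def)
    next
      fix p q assume "{p, q} \<in> compress E"
      then obtain e where e: "e \<in> E" "{p, q} = shift E e" by (auto simp: compress_def)
      have inv: "f (?\<sigma> z) = f z" for z using xy by (auto simp: transpose_def)
      have "{p, q} \<in> E \<or> {?\<sigma> p, ?\<sigma> q} \<in> E"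
      proof (cases "moves E e")
        case True
        then have "e = ?\<sigma> ` {p, q}" using e by (simp add: shift_def)
        then show ?thesis using e(1) by simp
      qed (use e in \<open>simp add: shift_def\<close>)
      then show "f p \<le> Suc (f q)"
        using geo inv unfolding geodesic_def by metis
    qed (use geo in \<open>auto simp: geodesic_def\<close>)
  qed (use w w' ne xy in auto)
qed

end

section \<open>Folding a geodesic\<close>

text \<open>
The level of a path vertex is its index.
\<close>

definition path_reflection :: "(nat \<Rightarrow> 'a) \<Rightarrow> ('a \<Rightarrow> nat) \<Rightarrow> nat \<Rightarrow> nat \<Rightarrow> 'a \<Rightarrow> 'a" where
  "path_reflection v f d s z = (if z \<in> v ` {s - d..d} then v (s - f z) else z)"

text \<open>
The reflection \<open>k \<mapsto> s - k\<close> of the path with \<open>d \<le> s\<close>: the axis \<open>s / 2\<close> lies at or right of the centre,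
so every vertex right of the axis has a mirror image. The vertices \<open>v 0, \<dots>, v (s - d - 1)\<close> and all
vertices off the path are fixed.
\<close>

locale path_fold = maximal V E d for V :: "'a set" and E d +
  fixes v :: "nat \<Rightarrow> 'a" and f :: "'a \<Rightarrow> nat" and s :: nat
  assumes geo: "geodesic V E d v f" and s_ge: "d \<le> s" and s_less: "s < 2 * d"
begin

abbreviation \<sigma> :: "'a \<Rightarrow> 'a" where "\<sigma> \<equiv> path_reflection v f d s"

definition R :: "'a set" where "R = v ` {k. k \<le> d \<and> s < 2 * k}"

lemma path: "k \<le> d \<Longrightarrow> v k \<in> V" "k \<le> d \<Longrightarrow> f (v k) = k" "k < d \<Longrightarrow> {v k, v (Suc k)} \<in> E"
  and lipschitz: "{x, y} \<in> E \<Longrightarrow> f x \<le> Suc (f y)"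
  and off_path: "x \<in> V \<Longrightarrow> x \<notin> v ` {..d} \<Longrightarrow> 1 \<le> f x \<and> f x < d"
  using geo by (auto simp: geodesic_def)

lemma lipschitz': "{x, y} \<in> E \<Longrightarrow> f y \<le> Suc (f x)"
  using lipschitz by (simp add: insert_commute)

lemma v_eq_iff: "i \<le> d \<Longrightarrow> j \<le> d \<Longrightarrow> v i = v j \<longleftrightarrow> i = j"
  using path(2) by metis

lemma \<sigma>_path: "s - d \<le> k \<Longrightarrow> k \<le> d \<Longrightarrow> \<sigma> (v k) = v (s - k)"
  by (simp add: path_reflection_def path)

lemma \<sigma>_path_low: "k < s - d \<Longrightarrow> \<sigma> (v k) = v k"
  using v_eq_iff s_less by (auto simp: path_reflection_def)

lemma \<sigma>_off: "z \<notin> v ` {..d} \<Longrightarrow> \<sigma> z = z"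
  by (auto simp: path_reflection_def)

lemma R_iff: "k \<le> d \<Longrightarrow> v k \<in> R \<longleftrightarrow> s < 2 * k"
  using v_eq_iff by (auto simp: R_def)

lemma R_on_path: "z \<in> R \<Longrightarrow> z \<in> v ` {..d}"
  by (auto simp: R_def)

lemma reflection: "partial_reflection V \<sigma> R"
proof
  show "finite V" using one_cycleD(1)[OF one_cycle] .
  show "\<sigma> (\<sigma> x) = x" for x
  proof (cases "x \<in> v ` {s - d..d}")
    case True
    then obtain k where "x = v k" "s - d \<le> k" "k \<le> d" by auto
    then show ?thesis using s_ge by (simp add: \<sigma>_path)
  qed (auto simp: path_reflection_def)
  show "\<sigma> x \<in> V" if "x \<in> V" for x
    using that path(1,2) s_ge by (auto simp: path_reflection_def)
  show "R \<subseteq> V" using path(1) by (auto simp: R_def)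
  show "\<sigma> x \<notin> R" if "x \<in> R" for x
  proof -
    obtain k where "x = v k" "k \<le> d" "s < 2 * k" using \<open>x \<in> R\<close> by (auto simp: R_def)
    moreover from this have "\<sigma> x = v (s - k)" using s_ge s_less by (auto simp: \<sigma>_path)
    ultimately show ?thesis using s_ge by (simp add: R_iff)
  qed
  show "\<sigma> x = x" if "x \<notin> R" "\<sigma> x \<notin> R" for x
  proof (cases "x \<in> v ` {s - d..d}")
    case True
    then obtain k where k: "x = v k" "s - d \<le> k" "k \<le> d" by auto
    then have "\<not> s < 2 * k" "\<not> s < 2 * (s - k)" using that s_ge by (auto simp: \<sigma>_path R_iff)
    then have "s - k = k" using k s_ge by linarith
    then show ?thesis using k by (simp add: \<sigma>_path)
  qed (auto simp: path_reflection_def)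
qed

sublocale pr: partial_reflection V \<sigma> R by (rule reflection)

lemma \<sigma>_R_iff: "k \<le> d \<Longrightarrow> v k \<in> \<sigma> ` R \<longleftrightarrow> s - d \<le> k \<and> 2 * k < s"
proof -
  assume k: "k \<le> d"
  have "v k \<in> \<sigma> ` R \<longleftrightarrow> \<sigma> (v k) \<in> R" by (rule pr.mem_image_iff)
  also have "\<dots> \<longleftrightarrow> s - d \<le> k \<and> 2 * k < s"
  proof (cases "s - d \<le> k")
    case True
    then show ?thesis using k s_ge by (auto simp: \<sigma>_path R_iff)
  next
    case False
    then show ?thesis using k s_less by (auto simp: \<sigma>_path_low R_iff)
  qed
  finally show ?thesis .
qed

lemma off_not_R: "z \<notin> v ` {..d} \<Longrightarrow> z \<notin> R \<and> z \<notin> \<sigma> ` R"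
  using R_on_path pr.mem_image_iff \<sigma>_off by metis

lemma path_edge_stays: "k < d \<Longrightarrow> \<not> pr.moves E {v k, v (Suc k)}"
proof
  assume k: "k < d" and mv: "pr.moves E {v k, v (Suc k)}"
  then have R: "s < 2 * k \<or> s < 2 * Suc k"
    by (auto simp: pr.moves_def R_iff split: if_splits)
  then have "s - d \<le> k" using k s_less by arith
  then have "\<sigma> ` {v k, v (Suc k)} = {v (s - Suc k), v (Suc (s - Suc k))}"
    using k s_ge by (auto simp: \<sigma>_path Suc_diff_Suc)
  moreover have "s - Suc k < d" using \<open>s - d \<le> k\<close> s_ge k by linarith
  ultimately show False using mv path(3) by (simp add: pr.moves_def)
qed

lemma kept: "{p, q} \<in> E \<Longrightarrow> \<not> pr.moves E {p, q} \<Longrightarrow> {p, q} \<in> pr.compress E"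
  by (force simp: pr.compress_def pr.shift_def)

text \<open>
Since the path is induced, the only edge between the two sides is the one that straddles the axis.
\<close>

lemma crossing:
  assumes "e \<in> E" "e \<inter> R \<noteq> {}" "e \<inter> \<sigma> ` R \<noteq> {}"
  shows "\<sigma> ` e = e"
proof -
  obtain p q where pq: "p \<in> e" "p \<in> R" "q \<in> e" "q \<in> \<sigma> ` R" using assms by blast
  obtain k where k: "p = v k" "k \<le> d" "s < 2 * k" using pq(2) by (auto simp: R_def)
  obtain l where l: "q = v l" "l \<le> d" using pq(4) off_not_R[of q] by auto
  have l2: "s - d \<le> l" "2 * l < s" using pq(4) \<sigma>_R_iff[OF l(2)] l(1) by simp_all
  obtain a b where "e = {a, b}" using one_cycleD(5)[OF one_cycle assms(1)] by blast
  moreover have "p \<noteq> q" using k l l2 v_eq_iff by auto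
  ultimately have e: "e = {p, q}" using pq(1,3) by auto
  have "k \<le> Suc l" using e lipschitz[of p q] assms(1) k l path(2) by simp
  then have "s - k = l" "s - l = k" using k l2 by linarith+
  moreover have "s - d \<le> k" using l2 k by linarith
  ultimately show ?thesis using k l l2 e by (auto simp: \<sigma>_path)
qed

text \<open>
The levels off the path are folded along the axis, in step with the edges that are moved.
\<close>

definition fold_level :: "'a \<Rightarrow> nat" where
  "fold_level z = (if z \<in> v ` {..d} then f z else min (f z) (s - f z))"

text \<open>
The critical case is an edge to the right half that stays: its mirror image is present too, so the
vertex off the path is adjacent to both \<open>v k\<close> and \<open>v (s - k)\<close>, and its level lies between theirs.
\<close>

lemma off_path_edge:
  assumes e: "{p, v k} \<in> pr.compress E" and p: "p \<notin> v ` {..d}" and k: "k \<le> d"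
  shows "fold_level p \<le> Suc k \<and> k \<le> Suc (fold_level p)"
proof -
  have lip: "f p \<le> Suc j \<and> j \<le> Suc (f p)" if "{p, v j} \<in> E" "j \<le> d" for j
    using lipschitz lipschitz' that path(2) by metis
  obtain e0 where e0: "e0 \<in> E" "{p, v k} = pr.shift E e0" using e by (auto simp: pr.compress_def)
  show ?thesis
  proof (cases "pr.moves E e0")
    case False
    then have E: "{p, v k} \<in> E" "\<not> pr.moves E {p, v k}" using e0 by (auto simp: pr.shift_def)
    show ?thesis
    proof (cases "s < 2 * k")
      case True
      then have "\<sigma> ` {p, v k} \<in> E"
        using E(2) off_not_R[OF p] k by (auto simp: pr.moves_def R_iff \<sigma>_R_iff)
      moreover have "s - d \<le> k" using True k by linarith
      ultimately have "{p, v (s - k)} \<in> E" using p k by (simp add: \<sigma>_off \<sigma>_path)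
      moreover have "s - k \<le> d" using \<open>s - d \<le> k\<close> by linarith
      ultimately show ?thesis
        using lip[of "s - k"] lip[OF E(1) k] True p k s_ge by (auto simp: fold_level_def min_def)
    next
      case False
      then show ?thesis using lip[OF E(1) k] p by (auto simp: fold_level_def min_def)
    qed
  next
    case True
    then have im: "{p, v k} = \<sigma> ` e0" using e0 by (simp add: pr.shift_def)
    then have e0': "e0 = {p, \<sigma> (v k)}" using p
      by (metis \<sigma>_off image_empty image_insert pr.image_image_involution)
    have "\<sigma> (v k) \<in> R" using True off_not_R[OF p] unfolding e0' pr.moves_def by auto
    then have k2: "s - d \<le> k" "2 * k < s" using k \<sigma>_R_iff pr.mem_image_iff by auto
    then have "{p, v (s - k)} \<in> E" using e0(1) e0' k by (simp add: \<sigma>_path)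
    moreover have "s - k \<le> d" using k2 by linarith
    ultimately show ?thesis
      using lip[of "s - k"] k2 k p s_ge by (auto simp: fold_level_def min_def)
  qed
qed

lemma fold_geodesic: "geodesic V (pr.compress E) d v fold_level"
  unfolding geodesic_def
proof (intro conjI allI impI ballI)
  show "v k \<in> V" "fold_level (v k) = k" if "k \<le> d" for k
    using that path by (auto simp: fold_level_def)
  show "{v k, v (Suc k)} \<in> pr.compress E" if "k < d" for k
    using that by (intro kept path path_edge_stays)
  show "1 \<le> fold_level x" "fold_level x < d" if "x \<in> V - v ` {..d}" for x
    using off_path[of x] that s_ge by (auto simp: fold_level_def)
  fix p q assume pq: "{p, q} \<in> pr.compress E"
  then obtain e where e: "e \<in> E" "{p, q} = pr.shift E e" by (auto simp: pr.compress_def)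
  consider "p \<notin> v ` {..d}" "q \<notin> v ` {..d}" | "p \<notin> v ` {..d}" "q \<in> v ` {..d}"
    | "p \<in> v ` {..d}" "q \<notin> v ` {..d}" | "p \<in> v ` {..d}" "q \<in> v ` {..d}" by blast
  then show "fold_level p \<le> Suc (fold_level q)"
  proof cases
    case 1
    have "{p, q} \<in> E"
    proof (cases "pr.moves E e")
      case True
      then have "\<sigma> ` e = {p, q}" using e by (simp add: pr.shift_def)
      then have "e = \<sigma> ` {p, q}" using pr.image_image_involution by metis
      also have "\<dots> = {p, q}" using 1 \<sigma>_off by simp
      finally show ?thesis using e(1) by simp
    qed (use e in \<open>simp add: pr.shift_def\<close>)
    then have "f p \<le> Suc (f q)" "f q \<le> Suc (f p)" using lipschitz lipschitz' by auto
    then show ?thesis using 1 by (auto simp: fold_level_def min_def)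
  next
    case 2
    then obtain k where "q = v k" "k \<le> d" by auto
    moreover from this have "fold_level q = k" by (simp add: fold_level_def path)
    ultimately show ?thesis using off_path_edge[of p k] pq 2 by simp
  next
    case 3
    then obtain k where "p = v k" "k \<le> d" by auto
    moreover from this have "fold_level p = k" by (simp add: fold_level_def path)
    ultimately show ?thesis using off_path_edge[of q k] pq 3 by (simp add: insert_commute)
  next
    case 4
    have "{p, q} \<in> E"
    proof (cases "pr.moves E e")
      case True
      then have im: "e = \<sigma> ` {p, q}" using e by (simp add: pr.shift_def)
      have "\<sigma> z \<in> v ` {..d}" if "z \<in> v ` {..d}" for z
        using that s_ge path(2) by (auto simp: path_reflection_def)
      then have "\<sigma> p \<in> v ` {..d}" "\<sigma> q \<in> v ` {..d}" using 4 by blast+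
      then obtain i j where "\<sigma> p = v i" "\<sigma> q = v j" and ij: "i \<le> d" "j \<le> d" by auto
      then have ij: "e = {v i, v j}" "i \<le> d" "j \<le> d" using im by auto
      then have "i \<noteq> j" using edgeD e(1) by blast
      moreover have "i \<le> Suc j" "j \<le> Suc i"
        using lipschitz lipschitz' ij e(1) path(2) by metis+
      ultimately consider "j = Suc i" | "i = Suc j" by linarith
      then have "\<not> pr.moves E e"
        using path_edge_stays ij by cases (auto simp: insert_commute)
      then show ?thesis using True by simp
    qed (use e in \<open>simp add: pr.shift_def\<close>)
    then show ?thesis using 4 lipschitz by (simp add: fold_level_def)
  qed
qed

lemma path_connected: "i \<le> j \<Longrightarrow> j \<le> d \<Longrightarrow> (v i, v j) \<in> (adj (pr.compress E))\<^sup>*"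
proof (induction rule: dec_induct)
  case (step k)
  have "(v k, v (Suc k)) \<in> adj (pr.compress E)"
    using fold_geodesic step by (auto simp: geodesic_def adj_def)
  then show ?case using step by (meson Suc_leD rtrancl.rtrancl_into_rtrancl)
qed simp

lemma right_connected:
  assumes "s < 2 * i" "s < 2 * j" "i \<le> d" "j \<le> d"
  shows "(v i, v j) \<in> {(x, y). x \<in> R \<and> y \<in> R \<and> {x, y} \<in> E}\<^sup>*" (is "_ \<in> ?C\<^sup>*")
proof -
  have up: "(v i, v j) \<in> ?C\<^sup>* \<and> (v j, v i) \<in> ?C\<^sup>*" if "i \<le> j" "s < 2 * i" "j \<le> d" for i j
    using that
  proof (induction rule: dec_induct)
    case (step k)
    then have "(v k, v (Suc k)) \<in> ?C" "(v (Suc k), v k) \<in> ?C"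
      using path(3)[of k] R_iff by (auto simp: insert_commute)
    then show ?case
      using step by (meson Suc_leD converse_rtrancl_into_rtrancl rtrancl.rtrancl_into_rtrancl)
  qed simp
  show ?thesis using up[of i j] up[of j i] assms by (cases "i \<le> j") auto
qed

text \<open>
The right half is connected along the path, so \<open>estrada_compress\<close> applies to a moving edge and an edge
without mirror image at any two positions.
\<close>

lemma no_edges_on_both_sides:
  assumes edge_A: "e \<in> E" "e \<inter> R = {}" "\<sigma> ` e \<notin> E" "v l \<in> e" "s - d \<le> l" "2 * l < s"
    and edge_B: "{w, v k} \<in> E" "w \<notin> v ` {..d}" "{w, v (s - k)} \<notin> E" "k \<le> d" "s < 2 * k"
  shows False
proof -
  have l: "l \<le> d" "s - l \<le> d" "s < 2 * (s - l)" using edge_A s_less by linarith+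
  have k: "s - d \<le> k" using edge_B s_less by linarith
  have "\<sigma> (v (s - l)) = v l" using edge_A(5,6) l s_ge by (auto simp: \<sigma>_path)
  moreover have "v (s - l) \<in> R" using l R_iff by simp
  moreover have "\<sigma> ` {w, v k} \<notin> E" using edge_B k by (simp add: \<sigma>_off \<sigma>_path)
  moreover have "{w, v k} \<inter> \<sigma> ` R = {}" using off_not_R edge_B \<sigma>_R_iff by auto
  moreover have "v k \<in> R" using edge_B R_iff by simp
  moreover have "(r, \<sigma> r) \<in> (adj (pr.compress E))\<^sup>*" if "r \<in> R" for r
  proof -
    obtain i where i: "r = v i" "i \<le> d" "s < 2 * i" using \<open>r \<in> R\<close> by (auto simp: R_def)
    then have "\<sigma> r = v (s - i)" using s_less by (auto simp: \<sigma>_path)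
    moreover have "(v (s - i), v i) \<in> (adj (pr.compress E))\<^sup>*" using i by (intro path_connected) auto
    ultimately show ?thesis using i adj_sym by simp
  qed
  ultimately show False
    using compression_gains_nothing[OF reflection crossing _ fold_geodesic edge_A(1-3) _ _ edge_B(1)
        _ _ _ _ right_connected[of k "s - l"]] edge_A(4) edge_B(4,5) l by simp
qed

end

section \<open>Positions of the vertices off the geodesic\<close>

lemma image_reverse: "(\<lambda>k. v (d - k)) ` {..d :: nat} = v ` {..d}"
proof -
  have "(\<lambda>k. d - k) ` {..d} = {..d}"
  proof (intro equalityI subsetI)
    fix x assume "x \<in> {..d}"
    then show "x \<in> (\<lambda>k. d - k) ` {..d}" by (intro image_eqI[where x = "d - x"]) auto
  qed auto
  then show ?thesis by (metis image_image)
qed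

context maximal
begin

lemma geodesic_reverse:
  assumes "geodesic V E d v f"
  shows "geodesic V E d (\<lambda>k. v (d - k)) (\<lambda>x. d - f x)"
proof -
  have edge: "{v (d - k), v (d - Suc k)} \<in> E" if "k < d" for k
  proof -
    have "{v (d - Suc k), v (Suc (d - Suc k))} \<in> E" using assms that by (simp add: geodesic_def)
    then show ?thesis using that by (simp add: Suc_diff_Suc insert_commute)
  qed
  have lip: "d - f x \<le> Suc (d - f y)" if "{x, y} \<in> E" for x y
  proof -
    have "f y \<le> Suc (f x)" using assms that unfolding geodesic_def by (metis insert_commute)
    then show ?thesis by linarith
  qed
  have off: "1 \<le> d - f x \<and> d - f x < d" if "x \<in> V" "x \<notin> v ` {..d}" for x
  proof -
    have "1 \<le> f x \<and> f x < d" using assms that by (simp add: geodesic_def)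
    then show ?thesis by linarith
  qed
  show ?thesis
    unfolding geodesic_def image_reverse using assms edge lip off by (auto simp: geodesic_def)
qed

lemma geodesicD:
  assumes "geodesic V E d v f"
  shows "k \<le> d \<Longrightarrow> v k \<in> V" "k \<le> d \<Longrightarrow> f (v k) = k" "k < d \<Longrightarrow> {v k, v (Suc k)} \<in> E"
    "{x, y} \<in> E \<Longrightarrow> f x \<le> Suc (f y) \<and> f y \<le> Suc (f x)"
    "x \<in> V \<Longrightarrow> x \<notin> v ` {..d} \<Longrightarrow> 1 \<le> f x \<and> f x < d"
    "i \<le> d \<Longrightarrow> j \<le> d \<Longrightarrow> v i = v j \<longleftrightarrow> i = j"
proof -
  show "f x \<le> Suc (f y) \<and> f y \<le> Suc (f x)" if "{x, y} \<in> E"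
    using assms that insert_commute unfolding geodesic_def by metis
  show "i \<le> d \<Longrightarrow> j \<le> d \<Longrightarrow> v i = v j \<longleftrightarrow> i = j"
    using assms unfolding geodesic_def by metis
qed (use assms in \<open>auto simp: geodesic_def\<close>)

text \<open>
If \<open>s > d\<close>, the path sticks out on the left, and its edge from \<open>v (s - d - 1)\<close> to \<open>v (s - d)\<close>, the mirror
image of \<open>v d\<close>, has no mirror image. Hence no attachment right of the axis may move.
\<close>

lemma attached_beyond_axis:
  assumes geo: "geodesic V E d v f" and s: "d < s" "s < 2 * d"
    and w: "{w, v k} \<in> E" "w \<notin> v ` {..d}" "k \<le> d" "s < 2 * k"
  shows "{w, v (s - k)} \<in> E"
proof (rule ccontr)
  assume no: "{w, v (s - k)} \<notin> E"
  interpret path_fold V E d v f s by unfold_locales (use geo s in auto)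
  let ?e = "{v (s - d - 1), v (s - d)}"
  have e: "?e \<in> E" using path(3)[of "s - d - 1"] s by (simp add: Suc_diff_Suc)
  have "v (s - d - 1) \<notin> R" "v (s - d) \<notin> R" using s by (auto simp: R_iff)
  then have disj: "?e \<inter> R = {}" by simp
  have "\<sigma> ` ?e = {v (s - d - 1), v d}" using s by (simp add: \<sigma>_path \<sigma>_path_low)
  moreover have "{v (s - d - 1), v d} \<notin> E"
  proof
    assume "{v (s - d - 1), v d} \<in> E"
    then have "f (v d) \<le> Suc (f (v (s - d - 1)))" by (rule lipschitz')
    then show False using s path(2) by simp
  qed
  ultimately have "\<sigma> ` ?e \<notin> E" by simp
  then show False
    by (rule no_edges_on_both_sides[OF e disj _ _ _ _ w(1,2) no w(3,4), where l = "s - d"])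
      (use s in auto)
qed

text \<open>
The symmetric axis \<open>s = d\<close>: no part of the path sticks out, and both edges have to come from vertices
off the path.
\<close>

lemma not_attached_on_both_sides:
  assumes geo: "geodesic V E d v f"
    and w: "{w, v k} \<in> E" "w \<notin> v ` {..d}" "k \<le> d" "d < 2 * k" "{w, v (d - k)} \<notin> E"
    and w': "{w', v l} \<in> E" "w' \<notin> v ` {..d}" "2 * l < d" "{w', v (d - l)} \<notin> E"
  shows False
proof -
  interpret path_fold V E d v f d by unfold_locales (use geo d_ge_2 in auto)
  have "{w', v l} \<inter> R = {}" using off_not_R[OF w'(2)] w' by (simp add: R_iff)
  moreover have "\<sigma> ` {w', v l} \<notin> E" using w' by (simp add: \<sigma>_path \<sigma>_off)
  ultimately show False
    by (rule no_edges_on_both_sides[OF w'(1) _ _ _ _ _ w(1,2,5,3,4), where l = l])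
      (use w' in auto)
qed

text \<open>
Fold just left of the position \<open>k\<close>: the axis \<open>s = 2 * k - 1\<close> forces an edge to \<open>v (k - 1)\<close>, and
\<open>s = 2 * k - 2\<close> one to \<open>v (k - 2)\<close>. Both together would create two triangles with a common edge, so
\<open>2 * k - 2 \<le> d\<close>.
\<close>

lemma attached_position_le:
  assumes geo: "geodesic V E d v f" and w: "{w, v k} \<in> E" "w \<notin> v ` {..d}" "k \<le> d"
  shows "2 * k \<le> d + 2" and "2 * k = d + 2 \<Longrightarrow> {w, v (k - 1)} \<in> E"
proof -
  note g = geodesicD[OF geo]
  have one: "{w, v (k - 1)} \<in> E" if "d + 2 \<le> 2 * k"
    using attached_beyond_axis[OF geo _ _ w(1,2,3), of "2 * k - 1"] that w(3) d_ge_2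
    by (simp add: mult_2)
  then show "2 * k = d + 2 \<Longrightarrow> {w, v (k - 1)} \<in> E" by simp
  show "2 * k \<le> d + 2"
  proof (rule ccontr)
    assume "\<not> 2 * k \<le> d + 2"
    then have k: "d + 3 \<le> 2 * k" "2 \<le> k" using d_ge_2 by linarith+
    have "2 * k - 2 - k = k - 2" by simp
    then have two: "{w, v (k - 2)} \<in> E"
      using attached_beyond_axis[OF geo _ _ w(1,2,3), of "2 * k - 2"] k w(3) by simp
    have "{v (k - 1), v k} \<in> E" using g(3)[of "k - 1"] k w(3) by simp
    moreover have "{v (k - 1), v (k - 2)} \<in> E"
      using g(3)[of "k - 2"] k w(3) by (simp add: insert_commute numeral_2_eq_2 Suc_diff_Suc)
    moreover have "distinct [w, v (k - 1), v k, v (k - 2)]"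
      using w k g(6) by auto
    ultimately show False
      using no_two_triangles[OF one_cycle, of w "v (k - 1)" "v k" "v (k - 2)"] one k w two by simp
  qed
qed

lemma attached_position_ge:
  assumes geo: "geodesic V E d v f" and w: "{w, v k} \<in> E" "w \<notin> v ` {..d}" "k \<le> d"
  shows "d \<le> 2 * k + 2" and "d = 2 * k + 2 \<Longrightarrow> {w, v (k + 1)} \<in> E"
proof -
  have im: "w \<notin> (\<lambda>k. v (d - k)) ` {..d}" using w(2) unfolding image_reverse .
  have "{w, v (d - (d - k))} \<in> E" using w by simp
  note a = attached_position_le[OF geodesic_reverse[OF geo] this im]
  show "d \<le> 2 * k + 2" using a(1) w(3) by simp
  show "{w, v (k + 1)} \<in> E" if "d = 2 * k + 2"
  proof -
    have "d - (d - k - 1) = k + 1" using that by simp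
    then show ?thesis using a(2) that by simp
  qed
qed

text \<open>
For even \<open>d\<close> only the centre and its neighbours are possible positions, and the latter come with an
edge to the centre. For odd \<open>d\<close> the two central positions remain, and by the symmetric fold one of
them attracts all attachments; reversing the path moves it to \<open>d div 2\<close>.
\<close>

lemma all_attached_at_centre:
  assumes "geodesic V E d v0 f0"
  obtains v f where "geodesic V E d v f"
    "\<And>w k. {w, v k} \<in> E \<Longrightarrow> w \<notin> v ` {..d} \<Longrightarrow> k \<le> d \<Longrightarrow> {w, v (d div 2)} \<in> E"
proof (cases "even d")
  case True
  then obtain a where a: "d = 2 * a" by blast
  have "{w, v0 a} \<in> E" if w: "{w, v0 k} \<in> E" "w \<notin> v0 ` {..d}" "k \<le> d" for w k
  proof -
    consider "k = a + 1" | "k = a" | "k + 1 = a"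
      using attached_position_le(1)[OF assms w] attached_position_ge(1)[OF assms w] a by linarith
    then show ?thesis
      using attached_position_le(2)[OF assms w] attached_position_ge(2)[OF assms w] a w(1)
      by cases auto
  qed
  then show ?thesis using that[OF assms] a by simp
next
  case False
  then obtain a where a: "d = 2 * a + 1" by (blast elim: oddE)
  have pos: "k = a \<or> k = a + 1" if w: "{w, v0 k} \<in> E" "w \<notin> v0 ` {..d}" "k \<le> d" for w k
    using attached_position_le(1)[OF assms w] attached_position_ge(1)[OF assms w] a by linarith
  show ?thesis
  proof (cases "\<exists>w. w \<notin> v0 ` {..d} \<and> {w, v0 (a + 1)} \<in> E \<and> {w, v0 a} \<notin> E")
    case False
    have "{w, v0 (d div 2)} \<in> E" if w: "{w, v0 k} \<in> E" "w \<notin> v0 ` {..d}" "k \<le> d" for w k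
      using pos[OF w] False w a by auto
    then show ?thesis using that[OF assms] by blast
  next
    case True
    then obtain w0 where w0: "w0 \<notin> v0 ` {..d}" "{w0, v0 (a + 1)} \<in> E" "{w0, v0 a} \<notin> E" by blast
    have "{w, v0 (a + 1)} \<in> E" if w: "{w, v0 k} \<in> E" "w \<notin> v0 ` {..d}" "k \<le> d" for w k
    proof (rule ccontr)
      assume no: "{w, v0 (a + 1)} \<notin> E"
      then have "{w, v0 a} \<in> E" using pos[OF w] w by auto
      then show False
        using not_attached_on_both_sides[OF assms w0(2,1), of w a] w0(3) w(2) no a by simp
    qed
    moreover have "d - d div 2 = a + 1" using a by simp
    ultimately show ?thesis
      using that[OF geodesic_reverse[OF assms]] unfolding image_reverse by (metis diff_le_self)
  qed
qed

text \<open>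
Otherwise some vertex \<open>y\<close> attached to \<open>v a\<close> has a neighbour \<open>u\<close> that is not attached. Compare \<open>y\<close> with
the path vertex of its own level, which is \<open>v a\<close> or a neighbour of \<open>v a\<close>. The neighbour \<open>u\<close> is private
to \<open>y\<close>, so \<open>y\<close> inherits the path neighbours of that vertex. This gives two triangles with a common
edge if the level is \<open>a\<close>, and an attachment at distance two from the centre otherwise.
\<close>

lemma off_path_adjacent_to_centre:
  assumes geo: "geodesic V E d v f"
    and centre: "\<And>w k. {w, v k} \<in> E \<Longrightarrow> w \<notin> v ` {..d} \<Longrightarrow> k \<le> d \<Longrightarrow> {w, v (d div 2)} \<in> E"
    and z: "z \<in> V" "z \<notin> v ` {..d}"
  shows "{z, v (d div 2)} \<in> E"
proof (rule ccontr)
  define a where "a = d div 2"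
  have a: "1 \<le> a" "a < d" "2 * a \<le> d" "d \<le> 2 * a + 1" using d_ge_2 by (auto simp: a_def)
  note g = geodesicD[OF geo]
  assume no: "{z, v (d div 2)} \<notin> E"
  let ?X = "{x \<in> V. x \<in> v ` {..d} \<or> {x, v a} \<in> E}"
  have "v 0 \<in> ?X" using g(1) by auto
  moreover have "z \<notin> ?X" using no z by (simp add: a_def)
  ultimately obtain y u where y: "y \<in> ?X" and u: "u \<in> V - ?X" and yu: "{y, u} \<in> E"
    using edge_leaving[OF one_cycle, of ?X] z by blast
  have u_off: "u \<notin> v ` {..d}" and u_a: "{u, v a} \<notin> E" using u by auto
  have u_P: "{u, v k} \<notin> E" if "k \<le> d" for k using centre[of u k] u_off u_a that by (auto simp: a_def)
  have y_off: "y \<notin> v ` {..d}"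
  proof
    assume "y \<in> v ` {..d}"
    then obtain k where "y = v k" "k \<le> d" by auto
    then show False using u_P[of k] yu by (simp add: insert_commute)
  qed
  then have ya: "{y, v a} \<in> E" using y by auto
  have yV: "y \<in> V" using y by simp
  have u_ne: "u \<noteq> v k" if "k \<le> d" for k using u_off that by auto
  have y_ne: "y \<noteq> v k" if "k \<le> d" for k using y_off that by auto
  have level: "1 \<le> f y" "f y < d" using g(5)[OF yV y_off] by auto
  have "f y \<le> Suc a" "a \<le> Suc (f y)" using g(4)[OF ya] g(2)[of a] a by auto
  then consider "f y = a" | "f y = a + 1" | "f y + 1 = a" by linarith
  then show False
  proof cases
    case 1
    from nested_neighbourhoods[OF geo, of "v a" y] consider
      "\<And>w. {y, w} \<in> E \<Longrightarrow> w \<noteq> v a \<Longrightarrow> {v a, w} \<in> E"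
      | "\<And>w. {v a, w} \<in> E \<Longrightarrow> w \<noteq> y \<Longrightarrow> {y, w} \<in> E"
      using g(1,2) a yV y_off y_ne[of a] ya 1 by (force simp: insert_commute)
    then show False
    proof cases
      case 1
      then show False using u_P[of a] u_ne[of a] yu a by (auto simp: insert_commute)
    next
      case 2
      have up: "{v a, v (a + 1)} \<in> E" using g(3)[of a] a by simp
      have down: "{v a, v (a - 1)} \<in> E" using g(3)[of "a - 1"] a by (simp add: insert_commute)
      have "distinct [v a, y, v (a + 1), v (a - 1)]"
        using y_ne[of a] y_ne[of "a + 1"] y_ne[of "a - 1"] g(6) a by auto
      then show False
        using no_two_triangles[OF one_cycle, of "v a" y "v (a + 1)" "v (a - 1)"]
          2[OF up] 2[OF down] up down ya y_ne[of "a + 1"] y_ne[of "a - 1"] a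
        by (auto simp: insert_commute)
    qed
  next
    case 2
    have aa: "a + 2 \<le> d" using 2 level by simp
    have up: "{v (a + 1), v a} \<in> E" "{v (a + 1), v (a + 2)} \<in> E"
      using g(3)[of a] g(3)[of "a + 1"] aa by (simp_all add: insert_commute)
    from nested_neighbourhoods[OF geo, of "v (a + 1)" y] consider
      "\<And>w. {y, w} \<in> E \<Longrightarrow> w \<noteq> v (a + 1) \<Longrightarrow> {v (a + 1), w} \<in> E"
      | "\<And>w. {v (a + 1), w} \<in> E \<Longrightarrow> w \<noteq> y \<Longrightarrow> {y, w} \<in> E"
      using g(1,2) aa yV y_off y_ne[of "a + 1"] ya up 2 by force
    then show False
    proof cases
      case 1
      then show False using u_P[of "a + 1"] u_ne[of "a + 1"] yu aa by (auto simp: insert_commute)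
    next
      case 2
      have "{y, v (a + 2)} \<in> E" using 2[OF up(2)] y_ne[of "a + 2"] aa by auto
      from attached_position_le(1)[OF geo this y_off aa] show False using a by simp
    qed
  next
    case 3
    have aa: "2 \<le> a" using 3 level by simp
    have down: "{v (a - 1), v a} \<in> E" "{v (a - 1), v (a - 2)} \<in> E"
      using g(3)[of "a - 1"] g(3)[of "a - 2"] aa a
      by (simp_all add: insert_commute numeral_2_eq_2 Suc_diff_Suc)
    from nested_neighbourhoods[OF geo, of "v (a - 1)" y] consider
      "\<And>w. {y, w} \<in> E \<Longrightarrow> w \<noteq> v (a - 1) \<Longrightarrow> {v (a - 1), w} \<in> E"
      | "\<And>w. {v (a - 1), w} \<in> E \<Longrightarrow> w \<noteq> y \<Longrightarrow> {y, w} \<in> E"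
      using g(1,2) aa a yV y_off y_ne[of "a - 1"] ya down 3 by force
    then show False
    proof cases
      case 1
      moreover have "a - 1 \<le> d" using a by simp
      ultimately show False using u_P[of "a - 1"] u_ne[of "a - 1"] yu by (auto simp: insert_commute)
    next
      case 2
      have le: "a - 2 \<le> d" using a by simp
      then have "{y, v (a - 2)} \<in> E" using 2[OF down(2)] y_ne[of "a - 2"] by auto
      from attached_position_ge(1)[OF geo this y_off le] show False using a aa by simp
    qed
  qed
qed

end

section \<open>Shape of the maximal graphs\<close>

definition path_edges :: "(nat \<Rightarrow> 'a) \<Rightarrow> nat \<Rightarrow> 'a set set" where
  "path_edges v d = (\<lambda>k. {v k, v (Suc k)}) ` {..<d}"

definition star :: "'a \<Rightarrow> 'a set \<Rightarrow> 'a set set" where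
  "star c W = (\<lambda>w. {c, w}) ` W"

text \<open>
The graph \<open>G\<^sup>d\<close> on the vertex set \<open>V\<close>: \<open>u\<close> is the apex of the triangle, and it belongs to the star of
the centre like the pendent vertices.
\<close>

definition extremal_shape :: "'a set \<Rightarrow> nat \<Rightarrow> 'a set set \<Rightarrow> (nat \<Rightarrow> 'a) \<Rightarrow> 'a \<Rightarrow> bool" where
  "extremal_shape V d E v u \<longleftrightarrow> inj_on v {..d} \<and> v ` {..d} \<subseteq> V \<and> u \<in> V - v ` {..d} \<and>
     E = path_edges v d \<union> star (v (d div 2)) (V - v ` {..d}) \<union> {{v (d div 2 + 1), u}}"

lemma path_edges_reverse: "path_edges (\<lambda>k. v (d - k)) d = path_edges v d"
proof -
  have "{v (d - k), v (d - Suc k)} = {v (d - Suc k), v (Suc (d - Suc k))}" if "k < d" for k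
    using that by (auto simp: Suc_diff_Suc)
  then have "path_edges (\<lambda>k. v (d - k)) d = (\<lambda>k. {v (d - Suc k), v (Suc (d - Suc k))}) ` {..<d}"
    unfolding path_edges_def by (intro image_cong) auto
  also have "\<dots> = (\<lambda>k. {v k, v (Suc k)}) ` (\<lambda>k. d - Suc k) ` {..<d}" by (simp add: image_image)
  also have "(\<lambda>k. d - Suc k) ` {..<d} = {..<d}"
  proof (intro equalityI subsetI)
    fix x assume "x \<in> {..<d}"
    then show "x \<in> (\<lambda>k. d - Suc k) ` {..<d}" by (intro image_eqI[where x = "d - Suc x"]) auto
  qed auto
  finally show ?thesis by (simp add: path_edges_def)
qed

context maximal
begin

lemma geodesic_inj: "geodesic V E d v f \<Longrightarrow> inj_on v {..d}"
  by (rule inj_on_inverseI[where g = f]) (simp add: geodesic_def)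

lemma card_path_and_star:
  assumes geo: "geodesic V E d v f" and large: "d + 2 \<le> card V" and c: "c \<in> v ` {..d}"
  shows "card (path_edges v d \<union> star c (V - v ` {..d})) = card V - 1"
proof -
  note g = geodesicD[OF geo]
  let ?W = "V - v ` {..d}"
  have fin: "finite ?W" using one_cycleD(1)[OF one_cycle] by simp
  have sub: "v ` {..d} \<subseteq> V" using g(1) by auto
  have inj: "inj_on v {..d}" by (rule geodesic_inj[OF geo])
  have "card ?W = card V - (d + 1)"
    using card_Diff_subset[OF _ sub] card_image[OF inj] by simp
  moreover have "inj_on (\<lambda>w. {c, w}) ?W" by (rule inj_onI) (auto simp: doubleton_eq_iff)
  then have "card (star c ?W) = card ?W" "finite (star c ?W)"
    using fin by (simp_all add: star_def card_image)
  moreover have "inj_on (\<lambda>k. {v k, v (Suc k)}) {..<d}"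
    by (rule inj_onI) (auto simp: doubleton_eq_iff g(6))
  then have "card (path_edges v d) = d" "finite (path_edges v d)"
    by (simp_all add: path_edges_def card_image)
  moreover have "path_edges v d \<inter> star c ?W = {}"
    by (auto simp: path_edges_def star_def doubleton_eq_iff)
  ultimately show ?thesis using large by (simp add: card_Un_disjoint)
qed

text \<open>
A triangle \<open>v a, p, q\<close> off the path is not maximal if \<open>v (a + 2)\<close> exists. The vertices \<open>p\<close> and \<open>q\<close> may be
assigned the levels \<open>a\<close> and \<open>a + 1\<close>. Then \<open>q\<close> and \<open>v (a + 1)\<close> have the same level and the common
neighbour \<open>v a\<close>, but the private neighbours \<open>p\<close> and \<open>v (a + 2)\<close>.
\<close>

lemma no_hanging_triangle:
  assumes geo: "geodesic V E d v f" and d: "d \<noteq> 2"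
    and E: "E = path_edges v d \<union> star (v (d div 2)) (V - v ` {..d}) \<union> {{p, q}}"
    and pq: "p \<in> V - v ` {..d}" "q \<in> V - v ` {..d}" "p \<noteq> q"
  shows False
proof -
  define a where "a = d div 2"
  have a: "1 \<le> a" "a + 2 \<le> d" using d_ge_2 d by (auto simp: a_def)
  note g = geodesicD[OF geo]
  \<comment> \<open>\<open>a + 2 \<le> d\<close> keeps the level \<open>a + 1\<close> of \<open>q\<close> inside the range allowed off the path.\<close>
  define h where "h z = (if z \<in> v ` {..d} then f z else if z = q then a + 1 else a)" for z
  have h_path: "h (v k) = k" if "k \<le> d" for k using that g(2) by (simp add: h_def)
  have h_off: "h z = (if z = q then a + 1 else a)" if "z \<in> V - v ` {..d}" for z
    using that by (simp add: h_def)
  have "geodesic V E d v h"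
    unfolding geodesic_def
  proof (intro conjI allI impI ballI)
    show "1 \<le> h x" "h x < d" if "x \<in> V - v ` {..d}" for x
      using a h_off[OF that] by auto
    fix x y assume "{x, y} \<in> E"
    then consider k where "{x, y} = {v k, v (Suc k)}" "k < d"
      | w where "{x, y} = {v a, w}" "w \<in> V - v ` {..d}" | "{x, y} = {p, q}"
      unfolding E path_edges_def star_def a_def by blast
    then show "h x \<le> Suc (h y)"
    proof cases
      case 1
      then show ?thesis using h_path[of k] h_path[of "Suc k"] by (auto simp: doubleton_eq_iff)
    next
      case 2
      then show ?thesis using h_path[of a] h_off[of w] a by (auto simp: doubleton_eq_iff)
    next
      case 3
      then show ?thesis using h_off[of p] h_off[of q] pq by (auto simp: doubleton_eq_iff)
    qed
  qed (use g in \<open>auto simp: h_path\<close>)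
  note nested = nested_neighbourhoods[OF this, of "v (a + 1)" q]
  have ne: "p \<noteq> v k" "q \<noteq> v k" if "k \<le> d" for k using pq that by auto
  have near: "{v (a + 1), v a} \<in> E" "{q, v a} \<in> E" "{v (a + 1), v (a + 2)} \<in> E"
    using g(3)[of a] g(3)[of "a + 1"] a pq by (auto simp: E star_def a_def insert_commute)
  have far: "{v (a + 1), p} \<notin> E" "{q, v (a + 2)} \<notin> E"
    using ne g(6)[of a "a + 1"] g(6)[of a "a + 2"] a pq
    by (auto simp: E path_edges_def star_def doubleton_eq_iff simp flip: a_def)
  have "{q, p} \<in> E" using E by (simp add: insert_commute)
  moreover have "h (v (a + 1)) = h q" using h_path h_off pq a by simp
  ultimately show False
    using nested near far g(1)[of "a + 1"] pq ne[of "a + 1"] ne[of "a + 2"] a by auto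
qed

text \<open>
For \<open>d = 2\<close> a triangle at the centre of the path is already the triangle of \<open>G\<^sup>d\<close>: let the path end in
\<open>p\<close> instead of \<open>v 2\<close>.
\<close>

lemma hanging_triangle_diameter_2:
  assumes geo: "geodesic V E d v f" and d: "d = 2"
    and E: "E = path_edges v d \<union> star (v (d div 2)) (V - v ` {..d}) \<union> {{p, q}}"
    and pq: "p \<in> V - v ` {..d}" "q \<in> V - v ` {..d}" "p \<noteq> q"
  shows "extremal_shape V d E (v(2 := p)) q"
proof -
  note g = geodesicD[OF geo]
  have up: "{..d} = {0, 1, 2}" "{..<d} = {0, 1}" using d by auto
  have ne: "v 0 \<noteq> v 1" "v 0 \<noteq> v 2" "v 1 \<noteq> v 2" using g(6) d by auto
  have vV: "v 2 \<in> V" "v 0 \<in> V" "v 1 \<in> V" using g(1) d by auto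
  have p: "p \<noteq> v 0" "p \<noteq> v 1" "p \<noteq> v 2" "q \<noteq> v 0" "q \<noteq> v 1" "q \<noteq> v 2"
    using pq unfolding up by auto
  have im: "v(2 := p) ` {..d} = {v 0, v 1, p}" "v ` {..d} = {v 0, v 1, v 2}" unfolding up by auto
  have "V - {v 0, v 1, v 2} = insert p (V - {v 0, v 1, v 2, p})" using pq p by auto
  moreover have "V - {v 0, v 1, p} = insert (v 2) (V - {v 0, v 1, v 2, p})" using vV ne p by auto
  moreover have "d div 2 = 1" using d by simp
  ultimately have "E = path_edges (v(2 := p)) d \<union> star ((v(2 := p)) (d div 2)) (V - v(2 := p) ` {..d})
      \<union> {{(v(2 := p)) (d div 2 + 1), q}}"
    unfolding E im path_edges_def star_def up by (simp add: numeral_2_eq_2) blast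
  moreover have "inj_on (v(2 := p)) {..d}" unfolding up using ne p by (auto simp: inj_on_def)
  ultimately show ?thesis
    unfolding extremal_shape_def im using pq p vV by auto
qed

text \<open>
The path and the edges to the centre are \<open>n - 1\<close> edges, so exactly one edge \<open>e\<close> is left. If it joins the
path to a vertex off the path, the admissible positions leave \<open>v (a + 1)\<close>, or \<open>v (a - 1)\<close> for even
\<open>d\<close>, where the reversed path has the same centre.
\<close>

lemma extremal_shape_if_star:
  assumes geo: "geodesic V E d v f"
    and centre: "\<And>w. w \<in> V \<Longrightarrow> w \<notin> v ` {..d} \<Longrightarrow> {w, v (d div 2)} \<in> E"
    and large: "d + 2 \<le> card V"
  shows "\<exists>v u. extremal_shape V d E v u"
proof -
  define a where "a = d div 2"
  have a: "1 \<le> a" "a < d" "2 * a \<le> d" "d \<le> 2 * a + 1" using d_ge_2 by (auto simp: a_def)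
  note g = geodesicD[OF geo]
  let ?B = "path_edges v d \<union> star (v a) (V - v ` {..d})"
  have inj: "inj_on v {..d}" by (rule geodesic_inj[OF geo])
  have sub: "v ` {..d} \<subseteq> V" using g(1) by auto
  have B: "?B \<subseteq> E"
    using g(3) centre by (auto simp: path_edges_def star_def a_def insert_commute)
  then have "card (E - ?B) = 1"
    using card_path_and_star[OF geo large, of "v a"] one_cycleD(2,3)[OF one_cycle] a large
    by (subst card_Diff_subset) (auto intro: finite_subset)
  then obtain e where "E - ?B = {e}" by (rule card_1_singletonE)
  then have E: "E = ?B \<union> {e}" and e: "e \<in> E" "e \<notin> path_edges v d" "e \<notin> star (v a) (V - v ` {..d})"
    using B by blast+
  have mixed: ?thesis if wk: "e = {w, v k}" "w \<in> V - v ` {..d}" "k \<le> d" for w k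
  proof -
    have w: "{w, v k} \<in> E" "w \<notin> v ` {..d}" using wk e by auto
    have "k \<noteq> a" using e(3) wk by (auto simp: star_def insert_commute)
    then consider "k = a + 1" | "k + 1 = a" "d = 2 * a"
      using attached_position_le(1)[OF geo w wk(3)] attached_position_ge(1)[OF geo w wk(3)] a
      by linarith
    then show ?thesis
    proof cases
      case 1
      then have "extremal_shape V d E v w"
        unfolding extremal_shape_def using inj sub wk E by (simp add: insert_commute a_def)
      then show ?thesis by blast
    next
      case 2
      let ?v = "\<lambda>k. v (d - k)"
      have "inj_on ?v {..d}"
        by (rule geodesic_inj[OF geodesic_reverse[OF geo]])
      moreover have "d - d div 2 = a" "d - (d div 2 + 1) = k" using 2 a_def by linarith+
      ultimately have "extremal_shape V d E ?v w"
        unfolding extremal_shape_def image_reverse path_edges_reverse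
        using sub wk E by (simp add: insert_commute)
      then show ?thesis by blast
    qed
  qed
  obtain p q where pq: "e = {p, q}" "p \<in> V" "q \<in> V" "p \<noteq> q"
    using one_cycleD(5)[OF one_cycle e(1)] by blast
  consider "p \<in> v ` {..d}" "q \<in> v ` {..d}" | "p \<in> V - v ` {..d}" "q \<in> v ` {..d}"
    | "q \<in> V - v ` {..d}" "p \<in> v ` {..d}" | "p \<in> V - v ` {..d}" "q \<in> V - v ` {..d}"
    using pq by blast
  then show ?thesis
  proof cases
    case 1
    then obtain i j where ij: "p = v i" "q = v j" "i \<le> d" "j \<le> d" by auto
    then have "i \<noteq> j" "i \<le> Suc j" "j \<le> Suc i" using pq g(2,4) e(1) by metis+
    then consider "j = Suc i" | "i = Suc j" by linarith
    then have "e \<in> path_edges v d"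
      using ij pq(1) by cases (auto simp: path_edges_def insert_commute)
    then show ?thesis using e by simp
  next
    case 2
    then obtain k where "q = v k" "k \<le> d" by auto
    then show ?thesis using mixed[of p k] 2 pq by simp
  next
    case 3
    then obtain k where "p = v k" "k \<le> d" by auto
    then show ?thesis using mixed[of q k] 3 pq by (simp add: insert_commute)
  next
    case 4
    have "E = path_edges v d \<union> star (v (d div 2)) (V - v ` {..d}) \<union> {{p, q}}"
      using E pq(1) by (simp add: a_def)
    then show ?thesis
      using no_hanging_triangle[OF geo _ _ 4 pq(4)] hanging_triangle_diameter_2[OF geo _ _ 4 pq(4)]
      by blast
  qed
qed

theorem maximal_has_extremal_shape:
  assumes "geodesic V E d v f" "d + 2 \<le> card V"
  shows "\<exists>v u. extremal_shape V d E v u"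
proof -
  obtain v f where geo: "geodesic V E d v f" and
    centre: "\<And>w k. {w, v k} \<in> E \<Longrightarrow> w \<notin> v ` {..d} \<Longrightarrow> k \<le> d \<Longrightarrow> {w, v (d div 2)} \<in> E"
    using all_attached_at_centre[OF assms(1)] by blast
  show ?thesis
    by (rule extremal_shape_if_star[OF geo off_path_adjacent_to_centre[OF geo centre] assms(2)])
qed

end

section \<open>Graphs, distances and isomorphisms\<close>

definition graph_of :: "'a set \<Rightarrow> 'a set set \<Rightarrow> 'a pair_pre_digraph" where
  "graph_of V E = \<lparr> pverts = V, parcs = adj E \<rparr>"

lemma graph_of_simps [simp]: "pverts (graph_of V E) = V" "parcs (graph_of V E) = adj E"
  by (simp_all add: graph_of_def)

lemma parcs_eq_adj_edges:
  assumes "pair_graph G"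
  shows "parcs G = adj (edges G)"
proof -
  interpret pair_graph G by fact
  show ?thesis
  proof (intro equalityI subrelI)
    fix x y assume "(x, y) \<in> parcs G"
    then show "(x, y) \<in> adj (edges G)" by (force simp: adj_def edges_def)
  next
    fix x y assume "(x, y) \<in> adj (edges G)"
    then obtain p q where "(p, q) \<in> parcs G" "{x, y} = {p, q}" by (auto simp: adj_def edges_def)
    then show "(x, y) \<in> parcs G" using arcs_symmetric by (auto simp: doubleton_eq_iff)
  qed
qed

lemma graph_of_edges:
  assumes "pair_graph G"
  shows "graph_of (pverts G) (edges G) = G"
  by (simp add: graph_of_def flip: parcs_eq_adj_edges[OF assms])

lemma edges_graph_of:
  assumes "one_cycle V E"
  shows "edges (graph_of V E) = E"
proof (intro equalityI subsetI)
  fix e assume "e \<in> E"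
  then obtain x y where "e = {x, y}" using one_cycleD(5)[OF assms] by blast
  then have "(x, y) \<in> adj E" "e = (\<lambda>(u, v). {u, v}) (x, y)" using \<open>e \<in> E\<close> by (auto simp: adj_def)
  then show "e \<in> edges (graph_of V E)" unfolding edges_def graph_of_simps by blast
qed (auto simp: edges_def adj_def)

lemma pair_graph_graph_of:
  assumes "one_cycle V E"
  shows "pair_graph (graph_of V E)"
proof
  have sub: "adj E \<subseteq> V \<times> V" using one_cycleD(6)[OF assms] by (auto simp: adj_def)
  show "finite (pverts (graph_of V E))" using one_cycleD(1)[OF assms] by simp
  then show "finite (parcs (graph_of V E))" using sub finite_subset by fastforce
  show "fst e \<in> pverts (graph_of V E)" "snd e \<in> pverts (graph_of V E)" if "e \<in> parcs (graph_of V E)" for e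
    using that sub by auto
  show "fst e \<noteq> snd e" if "e \<in> parcs (graph_of V E)" for e
    using that one_cycleD(6)[OF assms, of "fst e" "snd e"] by (auto simp: adj_def)
  show "symmetric (with_proj (graph_of V E))"
    by (auto simp: symmetric_def sym_def adj_def insert_commute)
qed

lemma reachable_graph_iff:
  assumes "pair_graph G" "x \<in> pverts G" "y \<in> pverts G"
  shows "x \<rightarrow>\<^sup>*\<^bsub>with_proj G\<^esub> y \<longleftrightarrow> (x, y) \<in> (parcs G)\<^sup>*"
proof -
  interpret pair_graph G by fact
  show ?thesis
  proof
    assume "x \<rightarrow>\<^sup>*\<^bsub>with_proj G\<^esub> y"
    then show "(x, y) \<in> (parcs G)\<^sup>*" using reachable_rtranclI by fastforce
  next
    assume "(x, y) \<in> (parcs G)\<^sup>*"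
    then show "x \<rightarrow>\<^sup>*\<^bsub>with_proj G\<^esub> y"
    proof (induction rule: rtrancl_induct)
      case base
      show ?case using assms by (intro reachable_refl) simp
    next
      case (step y z)
      then show ?case using reachable_adj_trans by simp
    qed
  qed
qed

lemma connected_iff:
  assumes "pair_graph G"
  shows "Digraph_Component.connected (with_proj G) \<longleftrightarrow>
    pverts G \<noteq> {} \<and> (\<forall>x\<in>pverts G. \<forall>y\<in>pverts G. (x, y) \<in> (parcs G)\<^sup>*)"
proof -
  interpret pair_graph G by fact
  have "(\<Union>e\<in>parcs G. {(fst e, snd e), (snd e, fst e)}) = parcs G"
    using arcs_symmetric by auto
  then have "mk_symmetric (with_proj G) = G" by (simp add: mk_symmetric_def)
  then show ?thesis
    using reachable_graph_iff[OF assms] by (auto simp: connected_def strongly_connected_def)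
qed

lemma one_cycle_if_unicyclic:
  assumes "unicyclic G"
  shows "one_cycle (pverts G) (edges G)"
proof -
  have pg: "pair_graph G" using assms by (simp add: unicyclic_def)
  interpret pair_graph G by fact
  have "\<exists>x\<in>pverts G. \<exists>y\<in>pverts G. x \<noteq> y \<and> e = {x, y}" if "e \<in> edges G" for e
  proof -
    obtain x y where "(x, y) \<in> parcs G" "e = {x, y}" using \<open>e \<in> edges G\<close> by (auto simp: edges_def)
    then show ?thesis using in_arcsD1 in_arcsD2 no_loops' by blast
  qed
  moreover have "card (edges G) = card (pverts G)" "Digraph_Component.connected (with_proj G)"
    using assms by (simp_all add: unicyclic_def)
  ultimately show ?thesis
    using pair_finite_verts connected_iff[OF pg] parcs_eq_adj_edges[OF pg]
    by (simp add: one_cycle_def)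
qed

lemma unicyclic_graph_of:
  assumes "one_cycle V E" "V \<noteq> {}"
  shows "unicyclic (graph_of V E)"
  using assms one_cycleD(3,4)[OF assms(1)]
  by (simp add: unicyclic_def pair_graph_graph_of connected_iff edges_graph_of)

lemma signless_off_diagonal:
  assumes "one_cycle V E" "a \<noteq> b"
  shows "signless E a b = of_bool ({a, b} \<in> E)"
proof -
  have "signless E a b = (\<Sum>e\<in>E. if e = {a, b} then 1 else 0)"
    unfolding signless_def
  proof (rule sum.cong)
    fix e assume "e \<in> E"
    then obtain x y where "e = {x, y}" "x \<noteq> y" using one_cycleD(5)[OF assms(1)] by blast
    then show "incidence e a * incidence e b = (if e = {a, b} then 1 else 0)"
      using assms(2) by (auto simp: incidence_def)
  qed simp
  then show ?thesis using one_cycleD(2)[OF assms(1)] by simp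
qed

lemma signless_diagonal:
  assumes "one_cycle V E"
  shows "signless E a a = real (out_degree (with_proj (graph_of V E)) a)"
proof -
  have "signless E a a = (\<Sum>e\<in>E. of_bool (a \<in> e))"
    unfolding signless_def by (rule sum.cong) (auto simp: incidence_def)
  also have "\<dots> = real (card {e \<in> E. a \<in> e})"
    using one_cycleD(2)[OF assms] by (simp add: of_bool_def sum.If_cases Int_def)
  also have "{e \<in> E. a \<in> e} = (\<lambda>(x, y). {x, y}) ` out_arcs (with_proj (graph_of V E)) a"
  proof (intro equalityI subsetI)
    fix e assume e: "e \<in> {e \<in> E. a \<in> e}"
    then obtain x y where "e = {x, y}" using one_cycleD(5)[OF assms] by blast
    then obtain b where "e = {a, b}" using e by auto
    then have "(a, b) \<in> out_arcs (with_proj (graph_of V E)) a" "e = (\<lambda>(x, y). {x, y}) (a, b)"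
      using e by (auto simp: out_arcs_def adj_def)
    then show "e \<in> (\<lambda>(x, y). {x, y}) ` out_arcs (with_proj (graph_of V E)) a" by blast
  qed (auto simp: out_arcs_def adj_def)
  also have "card \<dots> = card (out_arcs (with_proj (graph_of V E)) a)"
    by (rule card_image, rule inj_onI) (auto simp: out_arcs_def doubleton_eq_iff)
  finally show ?thesis by (simp add: out_degree_def)
qed

lemma SLEE_graph_of:
  assumes "one_cycle V E"
  shows "SLEE (graph_of V E) = estrada V E"
proof -
  have fin: "finite V" by (rule one_cycleD(1)[OF assms])
  define f where "f = from_nat_into V"
  have bij: "bij_betw f {..<card V} V"
    unfolding f_def by (rule bij_betw_from_nat_into_finite[OF fin])
  have ent: "signless E (f i) (f j) = (if i = j then real (out_degree (with_proj (graph_of V E)) (f i)) else 0)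
      + (if (f i, f j) \<in> adj E then 1 else 0)" if "i < card V" "j < card V" for i j
  proof (cases "i = j")
    case True
    have "(f i, f i) \<notin> adj E" using one_cycleD(6)[OF assms, of "f i" "f i"] by (auto simp: adj_def)
    then show ?thesis using True signless_diagonal[OF assms] by simp
  next
    case False
    then have "f i \<noteq> f j" using bij that by (auto simp: bij_betw_def dest: inj_onD)
    then show ?thesis using False signless_off_diagonal[OF assms] by (simp add: adj_def)
  qed
  have "signless_laplacian (graph_of V E) = mat (card V) (card V) (\<lambda>(i, j). signless E (f i) (f j))"
    by (rule eq_matI)
       (simp_all add: signless_laplacian_def degree_mat_def adjacency_mat_def ent flip: f_def)
  then show ?thesis
    using sums_unique[OF sum_exp_eigenvalues_sums[OF bij fin signless_commute[of E]]]
    by (simp add: SLEE_def estrada_def)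
qed

lemma awalk_relpow:
  assumes "pair_graph G" "x \<in> pverts G"
  shows "(\<exists>p. pre_digraph.awalk (with_proj G) x p y \<and> length p = k) \<longleftrightarrow> (x, y) \<in> parcs G ^^ k"
  using assms(2)
proof (induction k arbitrary: x)
  case 0
  then show ?case by (auto simp: pre_digraph.awalk_def pre_digraph.cas.simps)
next
  case (Suc k)
  interpret pair_graph G by fact
  show ?case
  proof
    assume "\<exists>p. awalk x p y \<and> length p = Suc k"
    then obtain e p where p: "awalk x (e # p) y" "length p = k" by (auto simp: length_Suc_conv)
    then have e: "fst e = x" "e \<in> parcs G" "awalk (snd e) p y" by (auto simp: awalk_Cons_iff)
    then have "(snd e, y) \<in> parcs G ^^ k" using Suc.IH[of "snd e"] p in_arcsD2 by (metis prod.collapse)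
    then show "(x, y) \<in> parcs G ^^ Suc k" using e by (metis prod.collapse relpow_Suc_I2)
  next
    assume "(x, y) \<in> parcs G ^^ Suc k"
    then obtain z where z: "(x, z) \<in> parcs G" "(z, y) \<in> parcs G ^^ k" by (metis relpow_Suc_D2)
    then obtain p where "awalk z p y" "length p = k" using Suc.IH[of z] in_arcsD2 by blast
    then have "awalk x ((x, z) # p) y" "length ((x, z) # p) = Suc k"
      using z by (auto simp: awalk_Cons_iff)
    then show "\<exists>p. awalk x p y \<and> length p = Suc k" by blast
  qed
qed

abbreviation gdist :: "'a pair_pre_digraph \<Rightarrow> 'a \<Rightarrow> 'a \<Rightarrow> ereal" where
  "gdist G \<equiv> wf_digraph.\<mu> (with_proj G) (\<lambda>_. 1)"

lemma gdist_le:
  assumes "pair_graph G" "x \<in> pverts G" "(x, y) \<in> parcs G ^^ k"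
  shows "gdist G x y \<le> ereal (real k)"
proof -
  interpret pair_graph G by fact
  obtain p where "awalk x p y" "length p = k" using awalk_relpow[OF assms(1,2)] assms(3) by blast
  then show ?thesis
    using min_cost_le_walk_cost[of x p y "\<lambda>_. 1"] by (simp add: awalk_cost_def sum_list_triv)
qed

lemma gdist_ge:
  assumes "pair_graph G" "x \<in> pverts G" "\<And>k. (x, y) \<in> parcs G ^^ k \<Longrightarrow> m \<le> k"
  shows "ereal (real m) \<le> gdist G x y"
proof -
  interpret pair_graph G by fact
  show ?thesis
    unfolding \<mu>_def
  proof (rule INF_greatest)
    fix p assume "p \<in> {p. awalk x p y}"
    then have "(x, y) \<in> parcs G ^^ length p" using awalk_relpow[OF assms(1,2)] by blast
    then show "ereal (real m) \<le> ereal (awalk_cost (\<lambda>_. 1) p)"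
      using assms(3) by (simp add: awalk_cost_def sum_list_triv)
  qed
qed

lemma SUP_attained:
  fixes f :: "'a \<Rightarrow> ereal"
  assumes "finite A" "A \<noteq> {}"
  shows "\<exists>x\<in>A. (SUP x\<in>A. f x) = f x"
proof -
  have "(SUP x\<in>A. f x) = Max (f ` A)" using assms by (simp add: Max_Sup)
  moreover have "Max (f ` A) \<in> f ` A" using assms by (intro Max_in) auto
  ultimately show ?thesis by auto
qed

text \<open>
The diameter is attained by a pair of vertices, and the distance from the first of them, clamped off a
shortest path, is a level function.
\<close>

lemma geodesic_if_diameter:
  assumes uni: "unicyclic G" and diam: "graph_diameter G = ereal (real d)" and d: "2 \<le> d"
  shows "\<exists>v f. geodesic (pverts G) (edges G) d v f"
proof -
  have pg: "pair_graph G" using uni by (simp add: unicyclic_def)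
  interpret pair_graph G by fact
  let ?R = "parcs G" and ?V = "pverts G"
  have conn: "?V \<noteq> {}" "\<And>x y. x \<in> ?V \<Longrightarrow> y \<in> ?V \<Longrightarrow> (x, y) \<in> ?R\<^sup>*"
    using uni connected_iff[OF pg] by (auto simp: unicyclic_def)
  have arcs: "(x, y) \<in> ?R \<longleftrightarrow> {x, y} \<in> edges G" for x y
    using parcs_eq_adj_edges[OF pg] by (simp add: adj_def)
  obtain s where s: "s \<in> ?V" "graph_diameter G = (SUP t\<in>?V. gdist G s t)"
    using SUP_attained[OF pair_finite_verts conn(1), of "\<lambda>u. SUP v\<in>?V. gdist G u v"]
    by (auto simp: graph_diameter_def)
  obtain t where t: "t \<in> ?V" "gdist G s t = ereal (real d)"
    using SUP_attained[OF pair_finite_verts conn(1), of "gdist G s"] s diam by auto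
  define D where "D x = (LEAST k. (s, x) \<in> ?R ^^ k)" for x
  have D: "(s, x) \<in> ?R ^^ D x" if "x \<in> ?V" for x
    unfolding D_def by (rule LeastI_ex) (rule rtrancl_imp_relpow[OF conn(2)[OF s(1) that]])
  have D_le: "D x \<le> k" if "(s, x) \<in> ?R ^^ k" for x k
    unfolding D_def using that by (rule Least_le)
  have "gdist G s t = ereal (real (D t))"
    using gdist_le[OF pg s(1) D[OF t(1)]] gdist_ge[OF pg s(1) D_le] by (rule antisym)
  then have Dt: "D t = d" using t by simp
  then obtain v where v: "v 0 = s" "v d = t" "\<And>i. i < d \<Longrightarrow> (v i, v (Suc i)) \<in> ?R"
    using D[OF t(1)] by (auto simp: relpow_fun_conv)
  have walk: "(v i, v j) \<in> ?R ^^ (j - i)" if "i \<le> j" "j \<le> d" for i j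
    using that
  proof (induction rule: dec_induct)
    case (step k)
    then show ?case using v(3)[of k] by (auto simp: Suc_diff_le)
  qed simp
  have vV: "v k \<in> ?V" if "k \<le> d" for k
    using that v(1) s(1) v(3)[of "k - 1"] in_arcsD2 by (cases k) auto
  have Dv: "D (v k) = k" if "k \<le> d" for k
  proof (rule antisym)
    show "D (v k) \<le> k" using D_le[of "v k" k] walk[of 0 k] that v(1) by simp
    have "(s, t) \<in> ?R ^^ (D (v k) + (d - k))"
      unfolding relpow_add
      by (rule relcompI[OF D[OF vV[OF that]]]) (use walk[of k d] that v(2) in simp)
    then have "D t \<le> D (v k) + (d - k)" by (rule D_le)
    then show "k \<le> D (v k)" using Dt that by linarith
  qed
  have lip: "D x \<le> Suc (D y)" if "{x, y} \<in> edges G" for x y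
  proof (rule D_le)
    have "(y, x) \<in> ?R" using that arcs by (simp add: insert_commute)
    then show "(s, x) \<in> ?R ^^ Suc (D y)" using D[of y] in_arcsD1 by (meson relpow_Suc_I)
  qed
  \<comment> \<open>Clamping keeps differences along edges at most one; \<open>2 \<le> d\<close> makes the range nonempty.\<close>
  define f where "f x = (if x \<in> v ` {..d} then D x else max 1 (min (D x) (d - 1)))" for x
  have "f x \<le> Suc (f y)" if "{x, y} \<in> edges G" for x y
  proof -
    have on: "D z \<le> d" if "z \<in> v ` {..d}" for z using that Dv by auto
    have "{y, x} \<in> edges G" using that by (simp add: insert_commute)
    then have D: "D x \<le> Suc (D y)" "D y \<le> Suc (D x)" using lip that by blast+
    show ?thesis
      using on[of x] on[of y] D d
      by (cases "x \<in> v ` {..d}"; cases "y \<in> v ` {..d}"; auto simp: f_def max_def min_def)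
  qed
  then have "geodesic ?V (edges G) d v f"
    unfolding geodesic_def using vV Dv v(3) arcs d by (auto simp: f_def)
  then show ?thesis by blast
qed

lemma geodesic_distance:
  assumes "geodesic V E d v f" "(x, y) \<in> adj E ^^ k"
  shows "f y \<le> f x + k"
  using assms(2)
proof (induction k arbitrary: y)
  case (Suc k)
  then obtain z where z: "(x, z) \<in> adj E ^^ k" "(z, y) \<in> adj E" by auto
  then have "f y \<le> Suc (f z)" using assms(1) by (simp add: geodesic_def adj_def insert_commute)
  then show ?case using Suc.IH[OF z(1)] by simp
qed simp

lemma relpow_adj_sym: "(x, y) \<in> adj E ^^ k \<Longrightarrow> (y, x) \<in> adj E ^^ k"
proof (induction k arbitrary: y)
  case (Suc k)
  then obtain z where z: "(x, z) \<in> adj E ^^ k" "(z, y) \<in> adj E" by auto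
  then have "(y, z) \<in> adj E" by (simp add: adj_def insert_commute)
  then show ?case using Suc.IH[OF z(1)] by (rule relpow_Suc_I2)
qed simp

lemma extremal_shape_close:
  assumes shape: "extremal_shape V d E v u" and d: "2 \<le> d" and xy: "x \<in> V" "y \<in> V"
  shows "\<exists>k\<le>d. (x, y) \<in> adj E ^^ k"
proof -
  define a where "a = d div 2"
  have a: "1 \<le> a" "a + 1 \<le> d" using d by (auto simp: a_def)
  have E: "E = path_edges v d \<union> star (v a) (V - v ` {..d}) \<union> {{v (a + 1), u}}"
    using shape by (simp add: extremal_shape_def a_def)
  have up: "(v i, v j) \<in> adj E ^^ (j - i)" if "i \<le> j" "j \<le> d" for i j
    using that
  proof (induction rule: dec_induct)
    case (step k)
    then have "(v k, v (Suc k)) \<in> adj E" by (auto simp: adj_def E path_edges_def)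
    then show ?case using step by (auto simp: Suc_diff_le)
  qed simp
  have path: "(v i, v j) \<in> adj E ^^ (max i j - min i j)" if "i \<le> d" "j \<le> d" for i j
  proof (cases "i \<le> j")
    case True
    then show ?thesis using up[of i j] that by (simp add: max_def min_def)
  next
    case False
    then have "(v j, v i) \<in> adj E ^^ (i - j)" using up[of j i] that by simp
    then show ?thesis using relpow_adj_sym False by (fastforce simp: max_def min_def)
  qed
  have off: "(v a, w) \<in> adj E" if "w \<in> V" "w \<notin> v ` {..d}" for w
    using that by (auto simp: adj_def E star_def)
  have mixed: "\<exists>k\<le>d. (v i, w) \<in> adj E ^^ k" if "i \<le> d" "w \<in> V" "w \<notin> v ` {..d}" for i w
  proof -
    have "(v i, w) \<in> adj E ^^ Suc (max i a - min i a)"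
      using path[of i a] off[OF that(2,3)] that(1) a by (meson add_leD1 relpow_Suc_I)
    moreover have "Suc (max i a - min i a) \<le> d" using that a by (auto simp: max_def min_def)
    ultimately show ?thesis by blast
  qed
  consider i j where "x = v i" "y = v j" "i \<le> d" "j \<le> d" | i where "x = v i" "i \<le> d" "y \<notin> v ` {..d}"
    | j where "y = v j" "j \<le> d" "x \<notin> v ` {..d}" | "x \<notin> v ` {..d}" "y \<notin> v ` {..d}" by blast
  then show ?thesis
  proof cases
    case 1
    moreover have "max i j - min i j \<le> d" using 1 by auto
    ultimately show ?thesis using path by blast
  next
    case 2
    then show ?thesis using mixed xy by blast
  next
    case 3
    then show ?thesis using mixed xy relpow_adj_sym by metis
  next
    case 4
    then have "(x, v a) \<in> adj E" "(v a, y) \<in> adj E"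
      using off[of x] off[of y] xy by (auto simp: adj_def insert_commute)
    then have "(x, y) \<in> adj E ^^ 2" by (auto simp: numeral_2_eq_2)
    then show ?thesis using d by blast
  qed
qed

lemma diameter_extremal_shape:
  assumes oc: "one_cycle V E" and geo: "geodesic V E d v f" and d: "2 \<le> d"
    and shape: "extremal_shape V d E v' u"
  shows "graph_diameter (graph_of V E) = ereal (real d)"
proof (rule antisym)
  have pg: "pair_graph (graph_of V E)" by (rule pair_graph_graph_of[OF oc])
  show "graph_diameter (graph_of V E) \<le> ereal (real d)"
    unfolding graph_diameter_def
  proof (intro SUP_least)
    fix x y assume "x \<in> pverts (graph_of V E)" "y \<in> pverts (graph_of V E)"
    then obtain k where "k \<le> d" "(x, y) \<in> parcs (graph_of V E) ^^ k" "x \<in> pverts (graph_of V E)"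
      using extremal_shape_close[OF shape d] by auto
    then show "gdist (graph_of V E) x y \<le> ereal (real d)"
      using gdist_le[OF pg] by (meson ereal_less_eq(3) of_nat_le_iff order_trans)
  qed
  have ends: "v 0 \<in> V" "v d \<in> V" "f (v 0) = 0" "f (v d) = d" using geo by (simp_all add: geodesic_def)
  then have "ereal (real d) \<le> gdist (graph_of V E) (v 0) (v d)"
    using geodesic_distance[OF geo, of "v 0" "v d"] by (intro gdist_ge pg) auto
  also have "\<dots> \<le> graph_diameter (graph_of V E)"
    unfolding graph_diameter_def using ends by (intro SUP_upper2[of "v 0"] SUP_upper2[of "v d"]) auto
  finally show "ereal (real d) \<le> graph_diameter (graph_of V E)" .
qed

text \<open>
Path vertices are numbered by position, \<open>u\<close> by \<open>d + 1\<close>, and the remaining vertices arbitrarily. The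
edges from the centre to \<open>u\<close> and to the remaining vertices together form the star of the centre.
\<close>

lemma iso_extremal_graph:
  assumes oc: "one_cycle V E" and d: "2 \<le> d" and shape: "extremal_shape V d E v u"
  shows "digraph_iso (with_proj (graph_of V E)) (with_proj (extremal_graph (card V) d))"
proof -
  define a n where "a = d div 2" and "n = card V"
  let ?W = "V - v ` {..d}"
  have inj: "inj_on v {..d}" and sub: "v ` {..d} \<subseteq> V" and u: "u \<in> V" "u \<notin> v ` {..d}"
    and E: "E = path_edges v d \<union> star (v a) ?W \<union> {{v (a + 1), u}}"
    using shape by (simp_all add: extremal_shape_def a_def)
  have fin: "finite V" by (rule one_cycleD(1)[OF oc])
  have "card (?W - {u}) = n - (d + 2)"
    using card_Diff_subset[OF _ sub] card_image[OF inj] u fin by (simp add: n_def)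
  then obtain g where g: "bij_betw g (?W - {u}) {d + 2..<n}"
    using finite_same_card_bij[of "?W - {u}" "{d + 2..<n}"] fin by auto
  define h where "h x = (if x \<in> v ` {..d} then the_inv_into {..d} v x else if x = u then d + 1 else g x)" for x
  have h_path: "h (v k) = k" if "k \<le> d" for k using that inj by (simp add: h_def the_inv_into_f_f)
  have h_u: "h u = d + 1" using u by (simp add: h_def)
  have h_rest: "h w = g w" if "w \<in> ?W - {u}" for w using that by (simp add: h_def)
  have img_rest: "h ` (?W - {u}) = {d + 2..<n}"
    using g h_rest by (simp add: bij_betw_def)
  have card_n: "d + 2 \<le> n"
  proof -
    have "card (insert u (v ` {..d})) \<le> card V" using fin sub u by (intro card_mono) auto
    then show ?thesis using u card_image[OF inj] by (simp add: n_def)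
  qed
  have V: "V = v ` {..d} \<union> {u} \<union> (?W - {u})" using sub u by auto
  have W: "?W = insert u (?W - {u})" using u by auto
  have img_path: "h ` v ` {..d} = {..d}" using h_path by (force simp: image_image)
  have img_W: "h ` ?W = {d + 1..<n}"
    using card_n by (subst W) (auto simp: img_rest h_u simp del: insert_Diff_single)
  have img: "h ` V = {0..<n}"
    using card_n by (subst V) (auto simp: image_Un img_rest h_u img_path)
  then have "inj_on h V" using fin by (intro eq_card_imp_inj_on) (simp_all add: n_def)
  define A where "A = (\<lambda>k. (v k, v (Suc k))) ` {..<d} \<union> Pair (v a) ` ?W \<union> {(v (a + 1), u)}"
  have "adj E = A \<union> A\<inverse>"
    unfolding adj_def E path_edges_def star_def A_def by (auto simp: doubleton_eq_iff)
  define H where "H = {(i, i + 1) | i. i < d} \<union> {(a, w) | w. d + 2 \<le> w \<and> w < n} \<union> {(d + 1, a), (d + 1, a + 1)}"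
  let ?h = "\<lambda>(x, y). (h x, h y)"
  have "?h ` A = (\<lambda>k. (k, Suc k)) ` {..<d} \<union> Pair a ` {d + 1..<n} \<union> {(a + 1, d + 1)}"
  proof -
    have "?h ` (\<lambda>k. (v k, v (Suc k))) ` {..<d} = (\<lambda>k. (k, Suc k)) ` {..<d}"
      unfolding image_image by (intro image_cong) (simp_all add: h_path)
    moreover have "?h ` Pair (v a) ` ?W = Pair a ` h ` ?W"
      unfolding image_image by (intro image_cong) (simp_all add: h_path a_def)
    moreover have "h (v (a + 1)) = a + 1" using h_path[of "a + 1"] d by (simp add: a_def)
    ultimately show ?thesis unfolding A_def image_Un by (simp add: img_W h_u)
  qed
  moreover have "?h ` (A\<inverse>) = (?h ` A)\<inverse>" by force
  moreover define K where "K = (\<lambda>k. (k, Suc k)) ` {..<d} \<union> Pair a ` {d + 1..<n} \<union> {(a + 1, d + 1)}"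
  ultimately have arcs_K: "?h ` adj E = K \<union> K\<inverse>"
    unfolding \<open>adj E = A \<union> A\<inverse>\<close> image_Un by simp
  have KH: "K \<subseteq> H \<union> H\<inverse>"
  proof -
    have "{d + 1..<n} = insert (d + 1) {d + 2..<n}" using card_n by auto
    then show ?thesis by (auto simp: K_def H_def)
  qed
  have HK: "H \<subseteq> K \<union> K\<inverse>" using card_n by (auto simp: K_def H_def)
  have arcs: "?h ` adj E = H \<union> H\<inverse>"
    unfolding arcs_K using KH HK by blast
  have Hgraph: "extremal_graph n d = \<lparr> pverts = {0..<n}, parcs = H \<union> H\<inverse> \<rparr>"
    by (simp add: extremal_graph_def H_def a_def Let_def)
  interpret pair_graph "graph_of V E" by (rule pair_graph_graph_of[OF oc])
  let ?f = "\<lparr> iso_verts = h, iso_arcs = ?h, iso_head = snd, iso_tail = fst \<rparr>"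
  have subV: "adj E \<subseteq> V \<times> V" using one_cycleD(6)[OF oc] by (auto simp: adj_def)
  have "inj_on ?h (adj E)"
    by (rule inj_on_subset[OF _ subV]) (use \<open>inj_on h V\<close> in \<open>auto simp: inj_on_def\<close>)
  then have "digraph_isomorphism ?f"
    using \<open>inj_on h V\<close> wf_digraph_axioms by (auto simp: digraph_isomorphism_def)
  moreover have "with_proj (extremal_graph n d) = app_iso ?f (with_proj (graph_of V E))"
    by (simp add: app_iso_def with_proj_def Hgraph img arcs)
  ultimately show ?thesis unfolding digraph_iso_def n_def by blast
qed

lemma finite_has_maximum:
  fixes f :: "'a \<Rightarrow> real"
  assumes "finite A" "A \<noteq> {}"
  obtains m where "m \<in> A" "\<And>x. x \<in> A \<Longrightarrow> f x \<le> f m"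
proof -
  obtain m where "m \<in> A" "Max (f ` A) = f m" using obtains_MAX[OF assms] by blast
  then show ?thesis using that Max_ge[of "f ` A"] assms(1) by (metis finite_imageI image_eqI)
qed

theorem theorem5p2:
  fixes G :: "'a pair_pre_digraph" and n d :: nat
  assumes "2 \<le> d" and "d + 2 \<le> n"
    and "unicyclic G" and "card (pverts G) = n" and "graph_diameter G = ereal (real d)"
    and "\<And>H :: 'a pair_pre_digraph.
           unicyclic H \<Longrightarrow> card (pverts H) = n \<Longrightarrow> graph_diameter H = ereal (real d) \<Longrightarrow>
           SLEE H \<le> SLEE G"
  shows "digraph_iso (with_proj G) (with_proj (extremal_graph n d))"
proof -
  define V E where "V = pverts G" and "E = edges G"
  have G: "graph_of V E = G"
    using assms(3) by (simp add: V_def E_def unicyclic_def graph_of_edges)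
  have oc: "one_cycle V E" using one_cycle_if_unicyclic[OF assms(3)] by (simp add: V_def E_def)
  obtain v f where geo: "geodesic V E d v f"
    using geodesic_if_diameter[OF assms(3,5,1)] by (auto simp: V_def E_def)
  have large: "d + 2 \<le> card V" "V \<noteq> {}" using assms(2,4) by (auto simp: V_def)
  let ?C = "{E. one_cycle V E \<and> (\<exists>v f. geodesic V E d v f)}"
  have "?C \<subseteq> Pow (Pow V)"
  proof
    fix F assume "F \<in> ?C"
    then have "one_cycle V F" by simp
    from one_cycleD(5)[OF this] show "F \<in> Pow (Pow V)" by fastforce
  qed
  then have "finite ?C" using one_cycleD(1)[OF oc] by (meson finite_Pow_iff finite_subset)
  moreover have "E \<in> ?C" using oc geo by blast
  ultimately obtain M where M: "M \<in> ?C" and max: "\<And>F. F \<in> ?C \<Longrightarrow> estrada V F \<le> estrada V M"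
    using finite_has_maximum[of ?C "estrada V"] by blast
  have shape: "\<exists>v u. extremal_shape V d F v u"
    if "F \<in> ?C" "\<And>F'. F' \<in> ?C \<Longrightarrow> estrada V F' \<le> estrada V F" for F
  proof -
    interpret maximal V F d by unfold_locales (use that assms(1) in auto)
    show ?thesis using maximal_has_extremal_shape that(1) large by blast
  qed
  \<comment> \<open>The maximiser \<open>M\<close> of the relaxed problem has diameter \<open>d\<close>, so \<open>G\<close> is at least as good as \<open>M\<close>.\<close>
  obtain vM fM where M': "one_cycle V M" "geodesic V M d vM fM" using M by blast
  obtain v' u' where "extremal_shape V d M v' u'" using shape[OF M max] by blast
  then have "graph_diameter (graph_of V M) = ereal (real d)"
    using diameter_extremal_shape[OF M' assms(1)] by blast
  then have "SLEE (graph_of V M) \<le> SLEE G"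
    using assms(4,6) unicyclic_graph_of[OF M'(1) large(2)] by (simp add: V_def)
  then have "estrada V M \<le> estrada V E"
    using SLEE_graph_of[OF M'(1)] SLEE_graph_of[OF oc] G by simp
  then obtain v'' u'' where "extremal_shape V d E v'' u''"
    using shape[of E] max oc geo by fastforce
  then show ?thesis
    using iso_extremal_graph[OF oc assms(1)] assms(4) by (simp add: G V_def[symmetric])
qed

end
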